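(* Let $x\in V$ (i.e. $x\colon[0,+\infty)\to\mathbb{R}$ is càdlàg with locally finite total variation), let $t>0$, and let $g:\mathbb{R}\to\mathbb{R}$ be Borel-measurable and locally bounded. Then \begin{align*} \int_{\mathbb{R}} \mathrm{u}^{z}(x,[0,t])\, g(z)\,dz &=\int_{(0,t]}g(x_{s-})\,(dx_{s})_{+}+\sum_{0<s\le t,\ \Delta x_{s}>0}\int_{x_{s-}}^{x_{s}}\{g(z)-g(x_{s-})\}\,dz\\ &=\int_{(0,t]}g(x_{s-})\,(dx^{cont}_{s})_{+}+\sum_{0<s\le t,\ \Delta x_{s}>0}\int_{x_{s-}}^{x_{s}}g(z)\,dz\\ &=\int_{(0,t]}g(x_{s})\,(dx^{cont}_{s})_{+}+\sum_{0<s\le t,\ \Delta x_{s}>0}\int_{x_{s-}}^{x_{s}}g(z)\,dz \end{align*} and \begin{align*} \int_{\mathbb{R}} \mathrm{d}^{z}(x,[0,t])\, g(z)\,dz &=\int_{(0,t]}g(x_{s-})\,(dx_{s})_{-}+\sum_{0<s\le t,\ \Delta x_{s}<0}\int_{x_{s}}^{x_{s-}}\{g(z)-g(x_{s-})\}\,dz\\ &=\int_{(0,t]}g(x_{s-})\,(dx^{cont}_{s})_{-}+\sum_{0<s\le t,\ \Delta x_{s}<0}\int_{x_{s}}^{x_{s-}}g(z)\,dz\\ &=\int_{(0,t]}g(x_{s})\,(dx^{cont}_{s})_{-}+\sum_{0<s\le t,\ \Delta x_{s}<0}\int_{x_{s}}^{x_{s-}}g(z)\,dz. \end{align*}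
   Context: **Spaces.** $D$ is the set of càdlàg functions $x\colon[0,+\infty)\to\mathbb{R}$ (right-continuous on $[0,+\infty)$, with left limits $x_{s-}$ at every $s>0$); $x_s=x(s)$. $V\subset D$ is the subset of functions with locally finite total variation: $\mathrm{TV}(x,[s,t]):=\sup_{\pi}\sum_{[u,v]\in\pi}|x_v-x_u|<\infty$ for all $0\le s<t<\infty$, where $\pi$ ranges over all finite partitions of $[s,t]$ into non-overlapping subintervals $[u,v]$. **Jumps and continuous part.** $\Delta x_s=x_s-x_{s-}$ for $s>0$. The continuous part $x^{cont}$ of $x\in V$ is defined by $x(t)=x^{cont}(t)+\sum_{0<s\le t}\Delta x_s$, $t\ge 0$. **Summation.** For a set $I$ and $b\colon I\to\mathbb{R}$, $\sum_{i\in I}b_i$ is the limit of the net of finite partial sums $\sum_{i\in\Gamma}b_i$, over finite $\Gamma\subseteq I$ directed by inclusion. **Positive and negative variation measures.** With $(y)_+=\max(0,y)$, $(y)_-=\max(0,-y)$, set $\mathrm{UTV}(x,[s,t]):=\sup_\pi\sum_{[u,v]\in\pi}(x_v-x_u)_+$ and $\mathrm{DTV}(x,[s,t]):=\sup_\pi\sum_{[u,v]\in\pi}(x_v-x_u)_-$. For $x\in V$, $\mu_+$ and $\mu_-$ are the unique measures on $[0,+\infty)$ with $\mu_\pm(\{0\})=0$, $\mu_+((a,b])=\mathrm{UTV}(x,[a,b])$ and $\mu_-((a,b])=\mathrm{DTV}(x,[a,b])$ for $0\le a<b<\infty$. One writes $\int_A h_s(dx_s)_+:=\int_A h\,d\mu_+$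 and $\int_A h_s(dx_s)_-:=\int_A h\,d\mu_-$. The integrals $\int_A h_s(dx^{cont}_s)_\pm$ are defined in the same way with $x^{cont}$ in place of $x$. **Interval crossings.** Let $y\in\mathbb{R}$, $c>0$, $x\in D$ and $0\le s<t$. Put $\sigma_0^c=s$ and, for $n=0,1,2,\dots$, $$\tau_n^c=\inf\{u\in[\sigma_n^c,t]: x(u)\ge y+c/2\},\qquad \sigma_{n+1}^c=\inf\{u\in[\tau_n^c,t]: x(u)<y-c/2\},$$ with the conventions $\inf\emptyset=+\infty$, $[+\infty,t]=\emptyset$. The number of downcrossings of $[y-c/2,y+c/2]$ by $x$ during $[s,t]$ is $\mathrm{d}^{y,c}(x,[s,t]):=\max\{n:\sigma_n^c\le t\}$, and the number of upcrossings is $\mathrm{u}^{y,c}(x,[s,t]):=\mathrm{d}^{-y,c}(-x,[s,t])$. **Level crossings.** For $y\in\mathbb{R}$, with values in $\{0,1,2,\dots\}\cup\{+\infty\}$, $$\mathrm{d}^{y}(x,[s,t])=\lim_{c\to0+}\mathrm{d}^{y,c}(x,[s,t]),\qquad \mathrm{u}^{y}(x,[s,t])=\lim_{c\to0+}\mathrm{u}^{y,c}(x,[s,t]).$$ *)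

theory Defs
  imports "HOL-Analysis.Analysis"
begin

text \<open>
  Functions on \<open>[0, +\<infinity>)\<close> are represented by functions on \<^typ>\<open>real\<close>; none of the notions below
  inspects their values at negative arguments when the times involved are nonnegative
  (positive, for left limits and jumps).
\<close>

definition cadlag :: "(real \<Rightarrow> real) \<Rightarrow> bool" where
  "cadlag x \<longleftrightarrow>
     (\<forall>s\<ge>0. (x \<longlongrightarrow> x s) (at_right s)) \<and> (\<forall>s>0. \<exists>l. (x \<longlongrightarrow> l) (at_left s))"

definition left_lim :: "(real \<Rightarrow> real) \<Rightarrow> real \<Rightarrow> real" where
  "left_lim x s = Lim (at_left s) x"

definition jump :: "(real \<Rightarrow> real) \<Rightarrow> real \<Rightarrow> real" where
  "jump x s = x s - left_lim x s"

definition cont_part :: "(real \<Rightarrow> real) \<Rightarrow> real \<Rightarrow> real" where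
  "cont_part x t = x t - (\<Sum>\<^sub>\<infinity>s\<in>{0<..t}. jump x s)"


text \<open>
  The supremum is over all finite divisions of \<open>[s, t]\<close> into non-overlapping closed intervals
  \<open>K = [u, v]\<close>, with \<open>u = Inf K\<close> and \<open>v = Sup K\<close>.
\<close>

definition variation :: "(real \<Rightarrow> real) \<Rightarrow> (real \<Rightarrow> real) \<Rightarrow> real \<Rightarrow> real \<Rightarrow> ennreal" where
  "variation \<phi> x s t =
     (SUP p\<in>{p. p division_of {s..t}}. \<Sum>K\<in>p. ennreal (\<phi> (x (Sup K) - x (Inf K))))"

definition TV :: "(real \<Rightarrow> real) \<Rightarrow> real \<Rightarrow> real \<Rightarrow> ennreal" where
  "TV = variation (\<lambda>y. \<bar>y\<bar>)"

definition UTV :: "(real \<Rightarrow> real) \<Rightarrow> real \<Rightarrow> real \<Rightarrow> ennreal" where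
  "UTV = variation (\<lambda>y. max 0 y)"

definition DTV :: "(real \<Rightarrow> real) \<Rightarrow> real \<Rightarrow> real \<Rightarrow> ennreal" where
  "DTV = variation (\<lambda>y. max 0 (- y))"

definition cadlag_fv :: "(real \<Rightarrow> real) set" where
  "cadlag_fv = {x. cadlag x \<and> (\<forall>s t. 0 \<le> s \<and> s < t \<longrightarrow> TV x s t < \<infinity>)}"


text \<open>The unique Borel measure on \<open>[0, +\<infinity>)\<close> without mass at 0 and with mass \<open>v a b\<close> on \<open>(a, b]\<close>.\<close>

definition measure_of_increments :: "(real \<Rightarrow> real \<Rightarrow> ennreal) \<Rightarrow> real measure" where
  "measure_of_increments v =
     (THE M. sets M = sets (restrict_space borel {0..}) \<and> emeasure M {0} = 0 \<and>
             (\<forall>a b. 0 \<le> a \<and> a < b \<longrightarrow> emeasure M {a<..b} = v a b))"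

definition pos_var :: "(real \<Rightarrow> real) \<Rightarrow> real measure" where
  "pos_var x = measure_of_increments (UTV x)"

definition neg_var :: "(real \<Rightarrow> real) \<Rightarrow> real measure" where
  "neg_var x = measure_of_increments (DTV x)"


text \<open>
  Crossing times take values in \<^typ>\<open>ereal\<close>, where \<open>Inf {} = \<infinity>\<close>; the set \<open>[r, t]\<close> is empty
  for \<open>r = \<infinity>\<close>.
\<close>

definition tau_after :: "(real \<Rightarrow> real) \<Rightarrow> real \<Rightarrow> real \<Rightarrow> real \<Rightarrow> ereal \<Rightarrow> ereal" where
  "tau_after x y c t r = Inf (ereal ` {u. r \<le> ereal u \<and> u \<le> t \<and> x u \<ge> y + c / 2})"

definition sigma_after :: "(real \<Rightarrow> real) \<Rightarrow> real \<Rightarrow> real \<Rightarrow> real \<Rightarrow> ereal \<Rightarrow> ereal" where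
  "sigma_after x y c t r = Inf (ereal ` {u. r \<le> ereal u \<and> u \<le> t \<and> x u < y - c / 2})"

primrec sigma :: "(real \<Rightarrow> real) \<Rightarrow> real \<Rightarrow> real \<Rightarrow> real \<Rightarrow> real \<Rightarrow> nat \<Rightarrow> ereal" where
  "sigma x y c s t 0 = ereal s"
| "sigma x y c s t (Suc n) = sigma_after x y c t (tau_after x y c t (sigma x y c s t n))"

definition downcrossings :: "real \<Rightarrow> real \<Rightarrow> (real \<Rightarrow> real) \<Rightarrow> real \<Rightarrow> real \<Rightarrow> nat" where
  "downcrossings y c x s t = Max {n. sigma x y c s t n \<le> ereal t}"

definition upcrossings :: "real \<Rightarrow> real \<Rightarrow> (real \<Rightarrow> real) \<Rightarrow> real \<Rightarrow> real \<Rightarrow> nat" where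
  "upcrossings y c x s t = downcrossings (- y) c (\<lambda>u. - x u) s t"

definition level_down :: "real \<Rightarrow> (real \<Rightarrow> real) \<Rightarrow> real \<Rightarrow> real \<Rightarrow> enat" where
  "level_down y x s t = Lim (at_right 0) (\<lambda>c. enat (downcrossings y c x s t))"

definition level_up :: "real \<Rightarrow> (real \<Rightarrow> real) \<Rightarrow> real \<Rightarrow> real \<Rightarrow> enat" where
  "level_up y x s t = Lim (at_right 0) (\<lambda>c. enat (upcrossings y c x s t))"

text \<open>The value 0 at \<open>\<infinity>\<close> is a convention, harmless for integrands that are finite almost everywhere.\<close>

definition real_of_enat :: "enat \<Rightarrow> real" where
  "real_of_enat n = real_of_ereal (ereal_of_enat n)"


definition locally_bounded :: "(real \<Rightarrow> real) \<Rightarrow> bool" where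
  "locally_bounded g \<longleftrightarrow> (\<forall>z. \<exists>U. open U \<and> z \<in> U \<and> bounded (g ` U))"

end

theory Submission
  imports Defs
begin

text \<open>
  For an upcrossing count \<open>N(z)\<close> of the level \<open>z\<close>, counting passages along a partition and integrating in
  \<open>z\<close> over \<open>A\<close> gives the positive variation of \<open>G \<circ> x\<close> along that partition, where \<open>G' = 1\<^sub>A\<close>. Refining the
  partition, \<open>\<integral> N dz = UTV x 0 t\<close>, and the measure \<open>N dz\<close> of a closed \<open>A\<close> is at most the positive variation
  of \<open>G \<circ> x\<close>. That variation is carried by the times with \<open>x s \<in> A\<close> and by the upward jumps, so it
  is dominated by the occupation measure of \<open>A\<close>, in which each upward jump spreads its mass
  uniformly over the interval jumped. Both measures have total mass \<open>UTV x 0 t\<close>; being ordered on all closed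
  half-lines they coincide. Splitting the occupation measure into its jump and non-jump parts
  yields the formulas for upcrossings, and \<open>x \<mapsto> -x\<close> those for downcrossings.
\<close>

section \<open>Positive variation of a path\<close>

text \<open>Positive variation is handled through one minimality principle: \<open>cumvar\<close> is
  the least function whose increments dominate the positive increments of \<open>x\<close>. For
  additivity, one-sided limits, the Jordan decomposition and the variation of the continuous part,
  the delicate inequality comes from exhibiting a competing majorant \<open>F\<close>.

  For crossings the obstacle is a level that is touched but not crossed. The values of
  \<open>x\<close> on uniform grids form a countable set, and for every other level a change of side
  between neighbouring grid points is a strict passage. Fatou's lemma then gives only an upper bound
  for the integral over \<open>A\<close>. Closedness of \<open>A\<close> enters because its
  complement is open: at a continuity time with \<open>x s\<close> outside \<open>A\<close>, the
  path stays for a while where \<open>G\<close> is constant. One-sided bounds are enough, since mass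
  missing on one half-line would have to reappear on the complementary one. The functions
  \<open>G\<close> for half-lines are \<open>min a\<close> and \<open>max a\<close>; the identity
  gives the total mass.\<close>

lemma sum_division_telescope:
  fixes F :: "real \<Rightarrow> 'b::real_normed_vector"
  assumes p: "p division_of {a..b}" and "a \<le> b"
  shows "(\<Sum>K\<in>p. F (Sup K) - F (Inf K)) = F b - F a"
proof -
  let ?q = "(\<lambda>K. (Inf K, K)) ` p"
  have inK: "Inf K \<in> K" if K: "K \<in> p" for K
  proof -
    obtain u v where "K = {u..v}" "K \<noteq> {}"
      using division_ofD(3,4)[OF p K] by auto
    then show ?thesis by auto
  qed
  have "?q tagged_division_of {a..b}"
  proof (rule tagged_division_ofI)
    show "finite ?q" using division_ofD(1)[OF p] by simp
    show "\<Union> {K. \<exists>x. (x, K) \<in> ?q} = {a..b}"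
      using division_ofD(6)[OF p] by (auto simp: image_iff)
  next
    fix x K assume "(x, K) \<in> ?q"
    then have K: "K \<in> p" "x = Inf K" by auto
    then show "x \<in> K" "K \<subseteq> {a..b}" "\<exists>a b. K = cbox a b"
      using inK division_ofD(2,4)[OF p] by auto
    fix x' K' assume "(x', K') \<in> ?q" "(x, K) \<noteq> (x', K')"
    then have "K' \<in> p" "K \<noteq> K'" using K by auto
    then show "interior K \<inter> interior K' = {}"
      using K division_ofD(5)[OF p] by auto
  qed
  from additive_tagged_division_1[OF \<open>a \<le> b\<close> this, of F] show ?thesis
    by (subst (asm) sum.reindex) (auto simp: inj_on_def)
qed

lemma division_of_realE:
  fixes a b :: real
  assumes "p division_of {a..b}" "K \<in> p"
  obtains u v where "K = {u..v}" "u \<le> v" "Inf K = u" "Sup K = v" "a \<le> u" "v \<le> b"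
proof -
  obtain u v where K: "K = {u..v}" "K \<noteq> {}"
    using division_ofD(3,4)[OF assms] by auto
  moreover have "K \<subseteq> {a..b}" using division_ofD(2)[OF assms] .
  ultimately show thesis by (intro that[of u v]) auto
qed

text \<open>Division sums of \<open>F\<close> telescope, so any function whose increments dominate
  the positive increments of \<open>x\<close> bounds the supremum. Most upper bounds on
  \<open>UTV\<close> arise in this way.\<close>

lemma UTV_leI:
  assumes "a \<le> b"
    and F: "\<And>u v. a \<le> u \<Longrightarrow> u \<le> v \<Longrightarrow> v \<le> b \<Longrightarrow> max 0 (x v - x u) \<le> F v - F u"
  shows "UTV x a b \<le> ennreal (F b - F a)"
  unfolding UTV_def variation_def
proof (rule SUP_least, safe)
  fix p assume p: "p division_of {a..b}"
  have "(\<Sum>K\<in>p. ennreal (max 0 (x (Sup K) - x (Inf K)))) = ennreal (\<Sum>K\<in>p. max 0 (x (Sup K) - x (Inf K)))"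
    by (rule sum_ennreal) simp
  also have "\<dots> \<le> ennreal (\<Sum>K\<in>p. F (Sup K) - F (Inf K))"
    by (intro ennreal_leI sum_mono) (use F in \<open>auto elim!: division_of_realE[OF p] simp del: max.bounded_iff\<close>)
  finally show "(\<Sum>K\<in>p. ennreal (max 0 (x (Sup K) - x (Inf K)))) \<le> ennreal (F b - F a)"
    using sum_division_telescope[OF p \<open>a \<le> b\<close>, of F] by simp
qed

lemma UTV_refl [simp]: "UTV x a a = 0"
proof -
  have "UTV x a a \<le> ennreal (0 - 0)"
    by (rule UTV_leI[where F = "\<lambda>_. 0"]) (auto dest: order.antisym)
  then show ?thesis by simp
qed

lemma UTV_ge_increment:
  assumes "a \<le> b"
  shows "ennreal (x b - x a) \<le> UTV x a b"
  unfolding UTV_def variation_def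
  using assms division_of_self[of a b]
  by (intro SUP_upper2[of "{{a..b}}"]) (auto simp: max_def intro!: ennreal_leI)

lemma UTV_superadditive:
  assumes "a \<le> b" "b \<le> c"
  shows "UTV x a b + UTV x b c \<le> UTV x a c"
proof -
  define S where "S p = (\<Sum>K\<in>p. ennreal (max 0 (x (Sup K) - x (Inf K))))" for p
  have V: "UTV x s t = (SUP p\<in>{p. p division_of {s..t}}. S p)" for s t
    by (simp add: UTV_def variation_def S_def)
  have ne: "{p. p division_of {s..t}} \<noteq> {}" for s t :: real
    using elementary_interval[of s t] by (auto simp: box_real)
  have le: "S p + S q \<le> UTV x a c" if p: "p division_of {a..b}" and q: "q division_of {b..c}" for p q
  proof -
    \<comment> \<open>The two divisions can share only the degenerate cell \<open>{b}\<close>, which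
      contributes 0; hence the sum over the union is the sum of the two sums.\<close>
    have "S (p \<inter> q) = 0"
      unfolding S_def
    proof (rule sum.neutral, safe)
      fix K assume "K \<in> p" "K \<in> q"
      have "Inf K \<le> Sup K" "Sup K \<le> b" using \<open>K \<in> p\<close> by (auto elim!: division_of_realE[OF p])
      moreover have "b \<le> Inf K" using \<open>K \<in> q\<close> by (auto elim!: division_of_realE[OF q])
      ultimately have "Sup K = Inf K" by simp
      then show "ennreal (max 0 (x (Sup K) - x (Inf K))) = 0" by simp
    qed
    moreover have "S (p \<union> q) + S (p \<inter> q) = S p + S q"
      unfolding S_def using division_ofD(1)[OF p] division_ofD(1)[OF q] by (rule sum.union_inter)
    ultimately have "S p + S q = S (p \<union> q)"
      by simp
    moreover have "(p \<union> q) division_of {a..b} \<union> {b..c}"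
      by (rule division_disjoint_union[OF p q]) auto
    moreover have "{a..b} \<union> {b..c} = {a..c}" using assms by auto
    ultimately show ?thesis unfolding V by (auto intro: SUP_upper)
  qed
  have "UTV x a b + S q \<le> UTV x a c" if q: "q division_of {b..c}" for q
    unfolding V[of a b] ennreal_SUP_add_left[OF ne, symmetric]
    by (rule SUP_least) (use le q in auto)
  then show ?thesis
    unfolding V[of b c] ennreal_SUP_add_right[OF ne]
    by (intro SUP_least) auto
qed

lemma UTV_mono_interval: "a \<le> b \<Longrightarrow> b \<le> c \<Longrightarrow> UTV x a b \<le> UTV x a c"
  by (rule order_trans[OF _ UTV_superadditive[of a b c]]) auto

text \<open>By superadditivity the function \<open>UTV x a\<close>, where finite, is itself a
  majorant of the positive increments; with \<open>UTV_leI\<close> it is the least one.\<close>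

lemma UTV_increment_le:
  assumes "a \<le> u" "u \<le> v" "UTV x a v < \<infinity>"
  shows "max 0 (x v - x u) \<le> enn2real (UTV x a v) - enn2real (UTV x a u)"
proof -
  have le: "UTV x a u + UTV x u v \<le> UTV x a v"
    using UTV_superadditive[OF assms(1,2)] .
  then have "UTV x a u < \<infinity>" "UTV x u v < \<infinity>"
    using assms(3) by (auto intro: le_less_trans[rotated])
  then obtain p q r where pqr: "UTV x a u = ennreal p" "UTV x u v = ennreal q" "UTV x a v = ennreal r"
      "p \<ge> 0" "q \<ge> 0" "r \<ge> 0"
    using assms(3) by (cases "UTV x a u"; cases "UTV x u v"; cases "UTV x a v") auto
  have "p + q \<le> r" using le pqr by (simp flip: ennreal_plus)
  moreover have "x v - x u \<le> q"
    using UTV_ge_increment[OF assms(2), of x] pqr by (simp add: ennreal_le_iff)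
  ultimately show ?thesis using pqr by simp
qed

lemma UTV_le_TV: "UTV x a b \<le> TV x a b"
  unfolding UTV_def TV_def variation_def
  by (intro SUP_mono) (auto intro!: sum_mono ennreal_leI)

lemma TV_mono_increments:
  assumes "\<And>u v. a \<le> u \<Longrightarrow> u \<le> v \<Longrightarrow> v \<le> b \<Longrightarrow> \<bar>y v - y u\<bar> \<le> \<bar>x v - x u\<bar>"
  shows "TV y a b \<le> TV x a b"
  unfolding TV_def variation_def
proof (intro SUP_mono)
  fix p assume p: "p \<in> {p. p division_of {a..b}}"
  have "(\<Sum>K\<in>p. ennreal \<bar>y (Sup K) - y (Inf K)\<bar>) \<le> (\<Sum>K\<in>p. ennreal \<bar>x (Sup K) - x (Inf K)\<bar>)"
    by (intro sum_mono ennreal_leI) (use assms p in \<open>auto elim!: division_of_realE\<close>)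
  with p show "\<exists>q\<in>{p. p division_of {a..b}}. (\<Sum>K\<in>p. ennreal \<bar>y (Sup K) - y (Inf K)\<bar>) \<le> (\<Sum>K\<in>q. ennreal \<bar>x (Sup K) - x (Inf K)\<bar>)"
    by blast
qed

lemma DTV_eq_UTV_uminus: "DTV x = UTV (\<lambda>s. - x s)"
  by (simp add: DTV_def UTV_def variation_def fun_eq_iff)

section \<open>The cumulative positive variation and its one-sided limits\<close>

locale fv_path =
  fixes x :: "real \<Rightarrow> real"
  assumes x_fv: "x \<in> cadlag_fv"
begin

lemma right_cont: "s \<ge> 0 \<Longrightarrow> (x \<longlongrightarrow> x s) (at_right s)"
  using x_fv by (simp add: cadlag_fv_def cadlag_def)

lemma tendsto_left_lim:
  assumes "s > 0"
  shows "(x \<longlongrightarrow> left_lim x s) (at_left s)"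
proof -
  obtain l where l: "(x \<longlongrightarrow> l) (at_left s)"
    using x_fv assms by (auto simp: cadlag_fv_def cadlag_def)
  then have "left_lim x s = l"
    unfolding left_lim_def by (intro tendsto_Lim) auto
  with l show ?thesis by simp
qed

lemma UTV_finite: "0 \<le> a \<Longrightarrow> a \<le> b \<Longrightarrow> UTV x a b < \<infinity>"
  using x_fv UTV_le_TV[of x a b] by (cases "a = b") (auto simp: cadlag_fv_def intro: le_less_trans)

text \<open>Constant 0 at negative times, so that it is monotone and right continuous on the whole
  line, as \<open>interval_measure\<close> asks.\<close>

definition cumvar :: "real \<Rightarrow> real" where
  "cumvar s = (if s < 0 then 0 else enn2real (UTV x 0 s))"

lemma ennreal_cumvar: "s \<ge> 0 \<Longrightarrow> ennreal (cumvar s) = UTV x 0 s"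
  using UTV_finite[of 0 s] by (simp add: cumvar_def)

lemma cumvar_nonneg: "cumvar s \<ge> 0"
  by (simp add: cumvar_def)

lemma cumvar_0 [simp]: "s \<le> 0 \<Longrightarrow> cumvar s = 0"
  by (cases "s = 0") (simp_all add: cumvar_def)

lemma UTV_le_cumvar_diff:
  assumes "0 \<le> a" "a \<le> b"
  shows "UTV x a b \<le> ennreal (cumvar b - cumvar a)"
proof -
  have "ennreal (cumvar a) + UTV x a b \<le> ennreal (cumvar b)"
    using UTV_superadditive[of 0 a b x] assms by (simp add: ennreal_cumvar)
  then obtain r where r: "UTV x a b = ennreal r" "r \<ge> 0"
    using UTV_finite[OF assms] by (cases "UTV x a b") auto
  with \<open>ennreal (cumvar a) + UTV x a b \<le> ennreal (cumvar b)\<close> have "cumvar a + r \<le> cumvar b"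
    by (simp add: cumvar_nonneg flip: ennreal_plus)
  then show ?thesis using r by (auto intro: ennreal_leI)
qed

lemma cumvar_increment:
  assumes "0 \<le> a" "a \<le> b"
  shows "max 0 (x b - x a) \<le> cumvar b - cumvar a"
proof -
  have "ennreal (cumvar a) \<le> ennreal (cumvar b)"
    using UTV_mono_interval[of 0 a b x] assms by (simp add: ennreal_cumvar)
  then have le: "cumvar a \<le> cumvar b" by (simp add: cumvar_nonneg)
  have "ennreal (x b - x a) \<le> ennreal (cumvar b - cumvar a)"
    using UTV_ge_increment[OF assms(2), of x] UTV_le_cumvar_diff[OF assms] by (rule order_trans)
  then show ?thesis using le by (simp add: ennreal_le_iff)
qed

lemma cumvar_mono: "a \<le> b \<Longrightarrow> cumvar a \<le> cumvar b"
  using cumvar_increment[of a b] cumvar_nonneg[of b] by (cases "a < 0") auto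

text \<open>Superadditivity gives one inequality. For the other, \<open>cumvar\<close> up to
  \<open>a\<close>, continued by the variation counted from \<open>a\<close>, is a majorant on
  \<open>{0..b}\<close>, hence not smaller than \<open>cumvar\<close> at \<open>b\<close>.\<close>

lemma UTV_eq_cumvar:
  assumes "0 \<le> a" "a \<le> b"
  shows "UTV x a b = ennreal (cumvar b - cumvar a)"
proof (rule antisym[OF UTV_le_cumvar_diff[OF assms]])
  define V where "V v = enn2real (UTV x a v)" for v
  have fin: "UTV x a v = ennreal (V v)" if "a \<le> v" for v
    using UTV_finite[of a v] assms that by (simp add: V_def)
  have Vinc: "max 0 (x v - x u) \<le> V v - V u" if "a \<le> u" "u \<le> v" for u v
    unfolding V_def using UTV_increment_le[of a u v x] UTV_finite[of a v] assms that by auto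
  define F where "F v = (if v \<le> a then cumvar v else cumvar a + V v)" for v
  have [simp]: "V a = 0" by (simp add: V_def)
  have "UTV x 0 b \<le> ennreal (F b - F 0)"
  proof (rule UTV_leI)
    fix u v assume uv: "0 \<le> u" "u \<le> v" "v \<le> b"
    show "max 0 (x v - x u) \<le> F v - F u"
      using cumvar_increment[of u v] Vinc[of u v] cumvar_increment[of u a] Vinc[of a v] uv assms
      by (auto simp: F_def)
  qed (use assms in simp)
  also have "F b - F 0 = cumvar a + V b" using assms by (auto simp: F_def)
  finally have "ennreal (cumvar b) \<le> ennreal (cumvar a + V b)" using assms by (simp add: ennreal_cumvar)
  then have "cumvar b \<le> cumvar a + V b" by (subst (asm) ennreal_le_iff) (auto simp: V_def cumvar_nonneg)
  then show "ennreal (cumvar b - cumvar a) \<le> UTV x a b"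
    by (simp add: fin[OF assms(2)] ennreal_leI)
qed

text \<open>The minimality principle: no majorant of the positive increments grows less than
  \<open>cumvar\<close>. The choice of \<open>F\<close> is the content of the proofs that rely on
  it.\<close>

lemma cumvar_leI:
  assumes "0 \<le> a" "a \<le> b" "F a \<le> F b"
    and "\<And>u v. a \<le> u \<Longrightarrow> u \<le> v \<Longrightarrow> v \<le> b \<Longrightarrow> max 0 (x v - x u) \<le> F v - F u"
  shows "cumvar b - cumvar a \<le> F b - F a"
  using UTV_leI[of a b x F, OF assms(2,4)] assms(3) by (simp add: UTV_eq_cumvar assms(1,2) ennreal_le_iff)

lemma cumvar_right_cont: "(cumvar \<longlongrightarrow> cumvar a) (at_right a)"
proof (cases "a < 0")
  case True
  then have "eventually (\<lambda>s. cumvar s = 0) (at_right a)"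
    by (auto simp: eventually_at_right_field intro!: exI[of _ 0])
  then show ?thesis using True by (simp add: tendsto_eventually)
next
  case False
  define l where "l = (INF s\<in>{a<..}. cumvar s)"
  have bdd: "bdd_below (cumvar ` {a<..})"
    by (rule bdd_belowI[of _ 0]) (auto simp: cumvar_nonneg)
  have l_le: "l \<le> cumvar s" if "s > a" for s
    unfolding l_def using that by (intro cINF_lower[OF bdd]) auto
  have l_ge: "cumvar a \<le> l"
    unfolding l_def by (rule cINF_greatest) (auto intro: cumvar_mono)
  have lim: "(cumvar \<longlongrightarrow> l) (at_right a)"
  proof (rule order_tendstoI)
    fix r assume "r < l"
    then show "eventually (\<lambda>s. r < cumvar s) (at_right a)"
      using l_le by (auto simp: eventually_at_right_field intro!: exI[of _ "a+1"] less_le_trans[of r l])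
  next
    fix r assume "l < r"
    then obtain s where "s > a" "cumvar s < r"
      unfolding l_def by (subst (asm) cINF_less_iff[OF _ bdd]) auto
    then show "eventually (\<lambda>s. cumvar s < r) (at_right a)"
      unfolding eventually_at_right_field by (intro exI[of _ s]) (meson cumvar_mono le_less_trans less_imp_le)
  qed
  text \<open>Subtracting a mass \<open>l - cumvar a\<close> at \<open>a\<close> from the variation leaves a bound for all increments.\<close>
  define F where "F v = (if v = a then cumvar a else cumvar v - (l - cumvar a))" for v
  have "cumvar (a+1) - cumvar a \<le> F (a+1) - F a"
  proof (rule cumvar_leI)
    show "F a \<le> F (a + 1)" using l_le[of "a+1"] by (simp add: F_def)
    fix u v assume uv: "a \<le> u" "u \<le> v" "v \<le> a + 1"
    show "max 0 (x v - x u) \<le> F v - F u"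
    proof (cases "u = a \<and> a < v")
      case True
      \<comment> \<open>Increments starting at \<open>a\<close> itself are the critical ones.
        Letting \<open>s\<close> decrease to \<open>a\<close> in the bound for increments from
        \<open>s\<close> puts the limit \<open>l\<close> in place of \<open>cumvar a\<close>; right
        continuity of \<open>x\<close> makes this legitimate.\<close>
      have "max 0 (x v - x a) \<le> cumvar v - l"
      proof (rule tendsto_le[OF trivial_limit_at_right_real])
        show "((\<lambda>s. cumvar v - cumvar s) \<longlongrightarrow> cumvar v - l) (at_right a)"
          by (intro tendsto_intros lim)
        show "((\<lambda>s. max 0 (x v - x s)) \<longlongrightarrow> max 0 (x v - x a)) (at_right a)"
          using False by (intro tendsto_intros right_cont) auto
        show "eventually (\<lambda>s. max 0 (x v - x s) \<le> cumvar v - cumvar s) (at_right a)"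
          using True False unfolding eventually_at_right_field
          by (intro exI[of _ v]) (auto intro!: cumvar_increment simp del: max.bounded_iff)
      qed
      then show ?thesis using True by (simp add: F_def)
    next
      case 2: False
      then show ?thesis using cumvar_increment[of u v] uv False by (auto simp: F_def)
    qed
  qed (use False in auto)
  then have "l = cumvar a" using l_ge by (simp add: F_def)
  with lim show ?thesis by simp
qed

text \<open>The atom of the variation at \<open>b\<close> is the positive part of the jump: at least
  that, by letting \<open>s\<close> tend to \<open>b\<close> in \<open>cumvar_increment\<close>, and
  not more, because a majorant jumping by just that amount exists.\<close>

lemma cumvar_left_lim:
  assumes "b > 0"
  shows "(cumvar \<longlongrightarrow> cumvar b - max 0 (jump x b)) (at_left b)"
proof -
  define l where "l = (SUP s\<in>{..<b}. cumvar s)"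
  have bdd: "bdd_above (cumvar ` {..<b})"
    by (rule bdd_aboveI[of _ "cumvar b"]) (auto intro: cumvar_mono)
  have le_l: "cumvar s \<le> l" if "s < b" for s
    unfolding l_def using that by (intro cSUP_upper[OF _ bdd]) auto
  have l_0: "0 \<le> l" using le_l[of 0] assms by simp
  have lim: "(cumvar \<longlongrightarrow> l) (at_left b)"
  proof (rule order_tendstoI)
    fix r assume "r < l"
    then obtain s where "s < b" "r < cumvar s"
      unfolding l_def by (subst (asm) less_cSUP_iff[OF _ bdd]) auto
    then show "eventually (\<lambda>s. r < cumvar s) (at_left b)"
      unfolding eventually_at_left_field by (intro exI[of _ s]) (meson cumvar_mono less_le_trans less_imp_le)
  next
    fix r assume "l < r"
    then show "eventually (\<lambda>s. cumvar s < r) (at_left b)"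
      using le_l by (auto simp: eventually_at_left_field intro!: exI[of _ "b-1"] le_less_trans[of _ l r])
  qed
  have jlim: "((\<lambda>s. max 0 (x b - x s)) \<longlongrightarrow> max 0 (jump x b)) (at_left b)"
    unfolding jump_def using assms by (intro tendsto_intros tendsto_left_lim)
  have ev: "eventually P (at_left b)" if "\<And>s. u < s \<Longrightarrow> s < b \<Longrightarrow> P s" "u < b" for P u
    using that by (auto simp: eventually_at_left_field)
  have "max 0 (jump x b) \<le> cumvar b - l"
    by (rule tendsto_le[OF trivial_limit_at_left_real tendsto_diff[OF tendsto_const lim] jlim])
      (rule ev[of 0], use assms in \<open>auto intro!: cumvar_increment simp del: max.bounded_iff\<close>)
  moreover have "cumvar b - cumvar 0 \<le> l + max 0 (jump x b)"
  proof -
    define F where "F v = (if v < b then cumvar v else l + max 0 (jump x b))" for v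
    have "cumvar b - cumvar 0 \<le> F b - F 0"
    proof (rule cumvar_leI)
      show "F 0 \<le> F b" using l_0 assms by (simp add: F_def)
      fix u v assume uv: "0 \<le> u" "u \<le> v" "v \<le> b"
      show "max 0 (x v - x u) \<le> F v - F u"
      proof (cases "u < b \<and> v = b")
        case True
        \<comment> \<open>An increment ending at \<open>b\<close> is split at an intermediate time
          \<open>s\<close>, which then tends to \<open>b\<close>.\<close>
        have "max 0 (x b - x u) \<le> max 0 (jump x b) + (l - cumvar u)"
        proof (rule tendsto_le[OF trivial_limit_at_left_real])
          show "((\<lambda>s. max 0 (x b - x s) + (cumvar s - cumvar u)) \<longlongrightarrow> max 0 (jump x b) + (l - cumvar u)) (at_left b)"
            by (intro tendsto_intros lim jlim)
          show "((\<lambda>s. max 0 (x b - x u)) \<longlongrightarrow> max 0 (x b - x u)) (at_left b)"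
            by simp
          show "eventually (\<lambda>s. max 0 (x b - x u) \<le> max 0 (x b - x s) + (cumvar s - cumvar u)) (at_left b)"
          proof (rule ev[of u])
            fix s assume "u < s" "s < b"
            then show "max 0 (x b - x u) \<le> max 0 (x b - x s) + (cumvar s - cumvar u)"
              using cumvar_increment[of u s] uv by auto
          qed (use True in simp)
        qed
        then show ?thesis using True by (simp add: F_def)
      next
        case False
        then have "u = v \<or> v < b" using uv by linarith
        then show ?thesis using cumvar_increment[of u v] uv by (auto simp: F_def)
      qed
    qed (use assms in auto)
    then show ?thesis using assms by (simp add: F_def)
  qed
  ultimately have "l = cumvar b - max 0 (jump x b)" unfolding cumvar_0[OF order_refl] by linarith
  with lim show ?thesis by simp
qed

end

section \<open>Negation, Lipschitz images and the Jordan decomposition\<close>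

lemma left_lim_uminus:
  assumes "(x \<longlongrightarrow> left_lim x s) (at_left s)"
  shows "left_lim (\<lambda>u. - x u) s = - left_lim x s"
  using tendsto_minus[OF assms] unfolding left_lim_def
  by (intro tendsto_Lim) auto

lemma cadlag_fv_comp:
  assumes "x \<in> cadlag_fv" "continuous_on UNIV G" "\<And>u v. \<bar>G u - G v\<bar> \<le> \<bar>u - v\<bar>"
  shows "(\<lambda>s. G (x s)) \<in> cadlag_fv"
proof -
  interpret fv_path x by unfold_locales fact
  have G: "isCont G u" for u using assms(2) by (simp add: continuous_on_eq_continuous_at)
  have "TV (\<lambda>s. G (x s)) a b < \<infinity>" if "0 \<le> a" "a < b" for a b
    using TV_mono_increments[of a b "\<lambda>s. G (x s)" x] assms(1,3) that
    by (auto simp: cadlag_fv_def intro: le_less_trans)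
  moreover have "cadlag (\<lambda>s. G (x s))"
    unfolding cadlag_def using isCont_tendsto_compose[OF G] right_cont tendsto_left_lim by blast
  ultimately show ?thesis by (simp add: cadlag_fv_def)
qed

lemma cadlag_fv_uminus: "x \<in> cadlag_fv \<Longrightarrow> (\<lambda>s. - x s) \<in> cadlag_fv"
  by (rule cadlag_fv_comp[of x uminus]) (auto intro: continuous_intros)

lemma jump_uminus: "x \<in> cadlag_fv \<Longrightarrow> s > 0 \<Longrightarrow> jump (\<lambda>s. - x s) s = - jump x s"
  using left_lim_uminus[OF fv_path.tendsto_left_lim[of x s]]
  by (simp add: jump_def fv_path_def)

text \<open>Two applications of minimality: \<open>N.cumvar + x\<close> is a majorant for
  \<open>x\<close>, and \<open>cumvar - x\<close> is one for \<open>-x\<close>; the two resulting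
  inequalities are opposite.\<close>

lemma (in fv_path) jordan:
  assumes "0 \<le> s"
  shows "x s - x 0 = cumvar s - fv_path.cumvar (\<lambda>u. - x u) s"
proof -
  interpret N: fv_path "\<lambda>u. - x u" by unfold_locales (rule cadlag_fv_uminus[OF x_fv])
  have "cumvar s - cumvar 0 \<le> (N.cumvar s + x s) - (N.cumvar 0 + x 0)"
  proof (rule cumvar_leI)
    show "N.cumvar 0 + x 0 \<le> N.cumvar s + x s"
      using N.cumvar_increment[of 0 s] assms by auto
    fix u v :: real assume "0 \<le> u" "u \<le> v"
    then show "max 0 (x v - x u) \<le> N.cumvar v + x v - (N.cumvar u + x u)"
      using N.cumvar_increment[of u v] by auto
  qed (use assms in auto)
  moreover have "N.cumvar s - N.cumvar 0 \<le> (cumvar s - x s) - (cumvar 0 - x 0)"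
  proof (rule N.cumvar_leI)
    show "cumvar 0 - x 0 \<le> cumvar s - x s"
      using cumvar_increment[of 0 s] assms by auto
    fix u v :: real assume "0 \<le> u" "u \<le> v"
    then show "max 0 (- x v - - x u) \<le> cumvar v - x v - (cumvar u - x u)"
      using cumvar_increment[of u v] by auto
  qed (use assms in auto)
  ultimately show ?thesis by simp
qed

section \<open>The positive variation measure and its continuous part\<close>

text \<open>On a countable set the measure has a density with respect to counting measure, namely
  the masses of the points. Integrability then is absolute summability, which yields the unordered
  sum.\<close>

lemma has_sum_integral_countable:
  fixes f :: "'a \<Rightarrow> real"
  assumes C: "countable C" "\<And>s. s \<in> C \<Longrightarrow> {s} \<in> sets M"
    and fin: "\<And>s. s \<in> C \<Longrightarrow> emeasure M {s} < \<infinity>"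
    and f: "set_integrable M C f"
  shows "((\<lambda>s. measure M {s} * f s) has_sum (LINT s:C|M. f s)) C"
proof -
  let ?g = "\<lambda>s. measure M {s} * f s"
  have CM: "C \<in> sets M" by (rule sets.countable[OF C(2,1)])
  then have int: "C \<inter> space M = C" using sets.sets_into_space[OF CM] by blast
  have sub: "X \<in> sets M" if "X \<subseteq> C" for X
    using C(2) that by (auto intro!: sets.countable[OF _ countable_subset[OF that C(1)]])
  have eq: "restrict_space M C = density (count_space C) (\<lambda>s. ennreal (measure M {s}))"
  proof (rule measure_eqI_countable[OF _ _ C(1)])
    show "sets (restrict_space M C) = Pow C"
    proof (intro equalityI subsetI)
      fix X assume "X \<in> Pow C"
      then have "X = C \<inter> X" "X \<in> sets M" using sub[of X] by auto
      then show "X \<in> sets (restrict_space M C)" unfolding sets_restrict_space by (rule image_eqI)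
    qed (auto simp: sets_restrict_space)
    fix a assume a: "a \<in> C"
    have "emeasure (density (count_space C) (\<lambda>s. ennreal (measure M {s}))) {a} = ennreal (measure M {a})"
      using a by (simp add: emeasure_density nn_integral_indicator_singleton' emeasure_count_space)
    also have "\<dots> = emeasure M {a}"
      using fin[OF a] by (simp add: emeasure_eq_ennreal_measure less_top)
    finally show "emeasure (restrict_space M C) {a} = emeasure (density (count_space C) (\<lambda>s. ennreal (measure M {s}))) {a}"
      using a CM int by (simp add: emeasure_restrict_space)
  qed simp
  have "integrable (restrict_space M C) f"
    using f CM int by (simp add: integrable_restrict_space set_integrable_def)
  then have int_g: "integrable (count_space C) ?g"
    unfolding eq by (subst (asm) integrable_density) auto
  then have abs: "Infinite_Set_Sum.abs_summable_on ?g C" by (simp add: Infinite_Set_Sum.abs_summable_on_def)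
  have "(LINT s:C|M. f s) = integral\<^sup>L (restrict_space M C) f"
    using CM int by (simp add: integral_restrict_space set_lebesgue_integral_def)
  also have "\<dots> = integral\<^sup>L (count_space C) ?g"
    unfolding eq by (subst integral_density) auto
  also have "\<dots> = infsum ?g C"
    using infsetsum_infsum[OF abs] by (simp add: infsetsum_def)
  finally show ?thesis
    using has_sum_infsum[OF abs_summable_summable[OF abs_summable_equivalent[THEN iffD2, OF abs]]] by simp
qed

lemma measure_eqI_Ioc:
  fixes M N :: "real measure"
  assumes sets: "sets M = sets borel" "sets N = sets borel"
    and eq: "\<And>a b. emeasure M {a<..b} = emeasure N {a<..b}"
    and fin: "\<And>a b. emeasure N {a<..b} < \<infinity>"
  shows "M = N"
proof (rule measure_eqI_generator_eq[where \<Omega>=UNIV and E="range (\<lambda>(a,b). {a<..b})" and A="\<lambda>n. {- real n<..real n}"])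
  show "Int_stable (range (\<lambda>(a, b). {a<..b::real}))"
    by (auto simp: Int_stable_def)
  show "sets M = sigma_sets UNIV (range (\<lambda>(a, b). {a<..b}))" "sets N = sigma_sets UNIV (range (\<lambda>(a, b). {a<..b}))"
    unfolding sets by (simp_all add: borel_sigma_sets_Ioc)
  show "(\<Union>i. {- real i<..real i}) = UNIV"
    by (auto simp: set_eq_iff) (metis abs_less_iff le_less minus_less_iff reals_Archimedean2)
  show "emeasure M {- real i<..real i} \<noteq> \<infinity>" for i
    using fin[of "- real i" "real i"] by (simp add: eq)
qed (auto simp: eq)

text \<open>Resolves the definite description, existence and uniqueness at once. The candidate is
  given on the whole line, where half-open intervals generate the Borel sets, and only then
  restricted.\<close>

lemma measure_of_increments_eqI:
  fixes M :: "real measure"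
  assumes sets: "sets M = sets borel" and null: "emeasure M {..0} = 0"
    and v: "\<And>a b. 0 \<le> a \<Longrightarrow> a < b \<Longrightarrow> emeasure M {a<..b} = v a b"
    and fin: "\<And>a b. 0 \<le> a \<Longrightarrow> a < b \<Longrightarrow> v a b < \<infinity>"
  shows "measure_of_increments v = restrict_space M {0..}"
proof -
  have sp: "space M = UNIV" using sets sets_eq_imp_space_eq[OF sets] by simp
  have emr: "emeasure (restrict_space M {0..}) A = emeasure M A" if "A \<subseteq> {0..}" for A
    using that by (intro emeasure_restrict_space) (simp_all add: sets sp)
  show ?thesis
    unfolding measure_of_increments_def
  proof (rule the_equality)
    have "emeasure M {0} \<le> emeasure M {..0}"
      by (rule emeasure_mono) (auto simp: sets)
    then have M0: "emeasure M {0} = 0" using null by simp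
    show "sets (restrict_space M {0..}) = sets (restrict_space borel {0..}) \<and>
        emeasure (restrict_space M {0..}) {0} = 0 \<and>
        (\<forall>a b. 0 \<le> a \<and> a < b \<longrightarrow> emeasure (restrict_space M {0..}) {a<..b} = v a b)"
    proof (intro conjI allI impI)
      show "sets (restrict_space M {0..}) = sets (restrict_space borel {0..})"
        by (simp add: sets_restrict_space sets)
      show "emeasure (restrict_space M {0..}) {0} = 0"
        using M0 by (simp add: emr)
      fix a b :: real assume ab: "0 \<le> a \<and> a < b"
      then have "{a<..b} \<subseteq> {0..}" by auto
      then show "emeasure (restrict_space M {0..}) {a<..b} = v a b"
        using ab v by (simp add: emr)
    qed
  next
    fix N :: "real measure"
    assume "sets N = sets (restrict_space borel {0..}) \<and> emeasure N {0} = 0 \<and>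
      (\<forall>a b. 0 \<le> a \<and> a < b \<longrightarrow> emeasure N {a<..b} = v a b)"
    then have N: "sets N = sets (restrict_space borel {0..})" "emeasure N {0} = 0"
        "\<And>a b. 0 \<le> a \<Longrightarrow> a < b \<Longrightarrow> emeasure N {a<..b} = v a b"
      by auto
    have spN: "space N = {0..}" using sets_eq_imp_space_eq[OF N(1)] by (simp add: space_restrict_space)
    have meas: "(\<lambda>x. x) \<in> measurable N borel"
      unfolding measurable_cong_sets[OF N(1) refl] by (rule measurable_restrict_space1) simp
    \<comment> \<open>The competitor lives on \<open>{0..}\<close>. Its image on the line can be
      compared with \<open>M\<close> interval by interval: both ignore \<open>{..0}\<close>, so left
      endpoints may be clipped at 0.\<close>
    define N' where "N' = distr N borel (\<lambda>x. x)"
    have N'A: "emeasure N' A = emeasure N (A \<inter> {0..})" if "A \<in> sets borel" for A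
      unfolding N'_def using that by (simp add: emeasure_distr[OF meas] spN)
    have clip: "emeasure L {a<..b} = emeasure L {max 0 a<..b}"
      if "sets L = sets borel" "emeasure L {..0} = 0" for L :: "real measure" and a b
    proof -
      have "{max 0 a<..b} = {a<..b} - {..0}" by auto
      then show ?thesis
        using that emeasure_Diff_null_set[of "{..0}" L "{a<..b}"] by (simp add: null_sets_def)
    qed
    have N'0: "emeasure N' {..0} = 0"
    proof -
      have "{..0} \<inter> {0..} = {0::real}" by auto
      then show ?thesis by (simp add: N'A N)
    qed
    have sets': "sets N' = sets borel" by (simp add: N'_def)
    have eqI: "emeasure N' {a<..b} = emeasure M {a<..b}" for a b :: real
    proof (cases "max 0 a < b")
      case True
      moreover have "{max 0 a<..b} \<inter> {0..} = {max 0 a<..b}" by auto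
      ultimately show ?thesis
        unfolding clip[OF sets' N'0, of a] clip[OF sets null, of a] by (simp add: N'A v N)
    next
      case False
      then have empty: "{max 0 a<..b} = {}" by simp
      show ?thesis
        unfolding clip[OF sets' N'0, of a] clip[OF sets null, of a] empty by simp
    qed
    have "N' = M"
    proof (rule measure_eqI_Ioc[OF sets' sets eqI])
      fix a b :: real
      show "emeasure M {a<..b} < \<infinity>"
        unfolding clip[OF sets null, of a] using v[of "max 0 a" b] fin[of "max 0 a" b]
        by (cases "max 0 a < b") auto
    qed
    show "N = restrict_space M {0..}"
    proof (rule measure_eqI)
      show "sets N = sets (restrict_space M {0..})" unfolding N(1) by (simp add: sets sets_restrict_space)
      fix A assume "A \<in> sets N"
      then have A: "A \<in> sets borel" "A \<subseteq> {0..}" by (auto simp: N(1) sets_restrict_space)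
      then have "emeasure N A = emeasure N' A" by (simp add: N'A Int_absorb2)
      also have "\<dots> = emeasure (restrict_space M {0..}) A"
        using A by (simp add: \<open>N' = M\<close> emr)
      finally show "emeasure N A = emeasure (restrict_space M {0..}) A" .
    qed
  qed
qed

section \<open>The variation measure, its atoms and the jump times\<close>

context fv_path
begin

lemma fv_path_uminus: "fv_path (\<lambda>s. - x s)"
  by unfold_locales (rule cadlag_fv_uminus[OF x_fv])

definition varm :: "real measure" where
  "varm = interval_measure cumvar"

lemma sets_varm [simp, measurable_cong]: "sets varm = sets borel"
  and space_varm [simp]: "space varm = UNIV"
  by (simp_all add: varm_def)

lemma emeasure_varm_Ioc: "a \<le> b \<Longrightarrow> emeasure varm {a<..b} = ennreal (cumvar b - cumvar a)"
  unfolding varm_def using cumvar_right_cont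
  by (intro emeasure_interval_measure_Ioc cumvar_mono) (simp_all add: continuous_within)

lemma emeasure_varm_Ioc_UTV: "0 \<le> a \<Longrightarrow> a \<le> b \<Longrightarrow> emeasure varm {a<..b} = UTV x a b"
  by (simp add: emeasure_varm_Ioc UTV_eq_cumvar)

lemma emeasure_varm_nonpos: "emeasure varm {..0} = 0"
proof -
  have "(\<Union>n. {- real n<..0}) = {..0}"
    by (auto simp: set_eq_iff) (metis minus_less_iff reals_Archimedean2)
  moreover have "emeasure varm (\<Union>n. {- real n<..0}) = 0"
    by (rule emeasure_UN_eq_0) (auto simp: emeasure_varm_Ioc)
  ultimately show ?thesis by simp
qed

text \<open>Half-open intervals shrinking to the point from the left show that the atom is the jump
  of \<open>cumvar\<close>. In particular downward jumps are null.\<close>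

lemma emeasure_varm_singleton:
  assumes "s > 0"
  shows "emeasure varm {s} = ennreal (max 0 (jump x s))"
proof (rule LIMSEQ_unique)
  let ?X = "\<lambda>n. s - 1 / real (Suc n)"
  have X: "?X \<longlonglongrightarrow> s"
    using tendsto_diff[OF tendsto_const LIMSEQ_inverse_real_of_nat, of s] by (simp add: divide_inverse)
  have "(\<lambda>n. emeasure varm {?X n<..s}) \<longlonglongrightarrow> emeasure varm (\<Inter>n. {?X n<..s})"
  proof (rule Lim_emeasure_decseq)
    show "decseq (\<lambda>n. {?X n<..s})"
      by (intro decseq_SucI) (auto intro!: le_less_trans[of "s - 1 / (1 + real n)" "s - 1 / (2 + real n)" for n] frac_le)
  qed (auto simp: emeasure_varm_Ioc)
  also have "(\<Inter>n. {?X n<..s}) = {s}"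
  proof (intro equalityI subsetI)
    fix u assume u: "u \<in> (\<Inter>n. {?X n<..s})"
    then have "s \<le> u"
      by (intro LIMSEQ_le_const2[OF X]) (auto intro: less_imp_le)
    then show "u \<in> {s}" using u by auto
  qed auto
  finally show "(\<lambda>n. emeasure varm {?X n<..s}) \<longlonglongrightarrow> emeasure varm {s}" .
  have "filterlim ?X (at_left s) sequentially"
    using X by (auto simp: filterlim_at)
  then have "(\<lambda>n. cumvar (?X n)) \<longlonglongrightarrow> cumvar s - max 0 (jump x s)"
    by (rule filterlim_compose[OF cumvar_left_lim[OF assms]])
  then have "(\<lambda>n. ennreal (cumvar s - cumvar (?X n))) \<longlonglongrightarrow> ennreal (cumvar s - (cumvar s - max 0 (jump x s)))"
    by (intro tendsto_ennrealI tendsto_intros)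
  then show "(\<lambda>n. emeasure varm {?X n<..s}) \<longlonglongrightarrow> ennreal (max 0 (jump x s))"
    by (simp add: emeasure_varm_Ioc)
qed

lemma measure_varm_singleton: "s > 0 \<Longrightarrow> measure varm {s} = max 0 (jump x s)"
  by (simp add: measure_def emeasure_varm_singleton)

lemma pos_var_eq: "pos_var x = restrict_space varm {0..}"
  unfolding pos_var_def
  by (rule measure_of_increments_eqI)
    (auto simp: emeasure_varm_nonpos emeasure_varm_Ioc_UTV UTV_finite[unfolded infinity_ennreal_def])

text \<open>Jumps of both signs, so that the set is the same for \<open>x\<close> and
  \<open>-x\<close>, and \<open>x\<close> is continuous at positive times off it.\<close>

definition jumps :: "real set" where
  "jumps = {s. s > 0 \<and> jump x s \<noteq> 0}"

text \<open>An upward jump of \<open>x\<close> is a discontinuity of the monotone function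
  \<open>cumvar\<close>.\<close>

lemma countable_pos_jumps: "countable {s. s > 0 \<and> jump x s > 0}"
proof (rule countable_subset[OF _ mono_ctble_discont])
  show "mono cumvar" by (auto intro: monoI cumvar_mono)
  show "{s. s > 0 \<and> jump x s > 0} \<subseteq> {s. \<not> isCont cumvar s}"
  proof safe
    fix s assume s: "s > 0" "jump x s > 0" "isCont cumvar s"
    then have "(cumvar \<longlongrightarrow> cumvar s) (at_left s)"
      by (simp add: isCont_def filterlim_at_split)
    from tendsto_unique[OF _ this cumvar_left_lim[OF s(1)]] s show False by simp
  qed
qed

end

context fv_path
begin

interpretation uminus: fv_path "\<lambda>s. - x s"
  by (rule fv_path_uminus)

lemma countable_jumps: "countable jumps"
proof -
  have "jumps \<subseteq> {s. s > 0 \<and> jump x s > 0} \<union> {s. s > 0 \<and> jump (\<lambda>s. - x s) s > 0}"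
    by (auto simp: jumps_def jump_uminus[OF x_fv])
  then show ?thesis
    by (rule countable_subset) (intro countable_Un countable_pos_jumps uminus.countable_pos_jumps)
qed

lemma jumps_borel [measurable, simp]: "jumps \<in> sets borel"
  by (rule sets.countable[OF _ countable_jumps]) simp

lemma uminus_jumps: "uminus.jumps = jumps"
  by (auto simp: uminus.jumps_def jumps_def jump_uminus[OF x_fv])

lemma emeasure_varm_finite: "B \<subseteq> {a<..b} \<Longrightarrow> emeasure varm B < \<infinity>"
proof (cases "a \<le> b")
  case True
  assume "B \<subseteq> {a<..b}"
  then have "emeasure varm B \<le> emeasure varm {a<..b}" by (intro emeasure_mono) auto
  then show ?thesis using True by (auto simp: emeasure_varm_Ioc less_top[symmetric] top_unique)
qed auto

lemma fmeasurable_varm: "B \<in> sets borel \<Longrightarrow> B \<subseteq> {a<..b} \<Longrightarrow> B \<in> fmeasurable varm"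
  using emeasure_varm_finite[of B a b] by (auto simp: fmeasurable_def)

lemma has_sum_pos_jumps:
  assumes "C \<subseteq> jumps" "C \<subseteq> {0<..b}"
  shows "((\<lambda>s. max 0 (jump x s)) has_sum measure varm C) C"
proof -
  have C: "countable C" using assms(1) countable_jumps by (rule countable_subset)
  then have CM: "C \<in> sets borel" by (rule sets.countable[rotated]) simp
  have "((\<lambda>s. measure varm {s} * 1) has_sum (LINT s:C|varm. 1)) C"
    using assms C CM emeasure_varm_finite[of C 0 b]
    by (intro has_sum_integral_countable)
      (auto simp: emeasure_varm_singleton set_integrable_def subset_eq)
  also have "(LINT s:C|varm. 1) = measure varm C"
    using CM by (simp add: set_lebesgue_integral_def)
  finally show ?thesis
    by (rule has_sum_cong[THEN iffD1, rotated]) (use assms in \<open>auto simp: measure_varm_singleton subset_eq\<close>)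
qed

section \<open>Variation of the continuous part\<close>

definition contvar :: "real \<Rightarrow> real" where
  "contvar s = measure varm ({0<..s} - jumps)"

definition jumpvar :: "real \<Rightarrow> real" where
  "jumpvar s = measure varm ({0<..s} \<inter> jumps)"

lemma cumvar_split: "s \<ge> 0 \<Longrightarrow> cumvar s = contvar s + jumpvar s"
proof -
  assume s: "s \<ge> 0"
  have "cumvar s = measure varm {0<..s}" using s by (simp add: measure_def emeasure_varm_Ioc cumvar_nonneg)
  also have "{0<..s} = ({0<..s} - jumps) \<union> ({0<..s} \<inter> jumps)" by auto
  also have "measure varm \<dots> = contvar s + jumpvar s"
    unfolding contvar_def jumpvar_def
    using emeasure_varm_finite[of _ 0 s] by (intro measure_Union) (auto simp: less_top)
  finally show ?thesis .
qed

lemma contvar_mono: "u \<le> v \<Longrightarrow> contvar u \<le> contvar v"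
  and jumpvar_mono: "u \<le> v \<Longrightarrow> jumpvar u \<le> jumpvar v"
  unfolding contvar_def jumpvar_def
  by (rule measure_mono_fmeasurable; force intro: fmeasurable_varm[of _ 0 v])+

lemma emeasure_varm_minus_jumps:
  assumes "0 \<le> a" "a \<le> b"
  shows "emeasure varm ({a<..b} - jumps) = ennreal (contvar b - contvar a)"
proof -
  have "contvar b = measure varm (({0<..a} - jumps) \<union> ({a<..b} - jumps))"
    unfolding contvar_def using assms by (intro arg_cong[where f="measure varm"]) auto
  also have "\<dots> = contvar a + measure varm ({a<..b} - jumps)"
    unfolding contvar_def
    using emeasure_varm_finite[of _ 0 a] emeasure_varm_finite[of _ a b]
    by (intro measure_Union) (auto simp: less_top)
  finally show ?thesis
    using emeasure_varm_finite[of "{a<..b} - jumps" a b] by (simp add: emeasure_eq_ennreal_measure less_top)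
qed

end

context fv_path
begin

interpretation uminus: fv_path "\<lambda>s. - x s"
  by (rule fv_path_uminus)

text \<open>A jump is the difference of the positive parts of the jumps of \<open>x\<close> and
  \<open>-x\<close>, and each of these two families sums to the mass of its atoms.\<close>

lemma infsum_jump:
  assumes "b \<ge> 0"
  shows "(\<Sum>\<^sub>\<infinity>s\<in>{0<..b}. jump x s) = jumpvar b - uminus.jumpvar b"
proof -
  let ?C = "{0<..b} \<inter> jumps"
  have "((\<lambda>s. max 0 (jump x s) + - max 0 (jump (\<lambda>s. - x s) s)) has_sum (jumpvar b + - uminus.jumpvar b)) ?C"
    unfolding jumpvar_def uminus.jumpvar_def uminus_jumps
    by (intro has_sum_add has_sum_uminusI has_sum_pos_jumps uminus.has_sum_pos_jumps) (auto simp: uminus_jumps)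
  then have "(jump x has_sum (jumpvar b + - uminus.jumpvar b)) {0<..b}"
    by (rule has_sum_cong_neutral[THEN iffD1, rotated -1]) (auto simp: jump_uminus[OF x_fv] jumps_def)
  then show ?thesis by (simp add: infsumI)
qed

lemma cont_part_eq:
  assumes "s \<ge> 0"
  shows "cont_part x s = x 0 + contvar s - uminus.contvar s"
  using infsum_jump[OF assms] jordan[OF assms] cumvar_split[OF assms] uminus.cumvar_split[OF assms]
  by (simp add: cont_part_def)

text \<open>Upper bound: by \<open>cont_part_eq\<close>, \<open>contvar\<close> is a majorant for
  the continuous part. Lower bound: the variation \<open>W\<close> of the continuous part plus
  \<open>jumpvar\<close> is a majorant for \<open>x\<close>, so minimality of \<open>cumvar\<close>
  applies and \<open>jumpvar\<close> cancels.\<close>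

lemma UTV_cont_part:
  assumes "0 \<le> a" "a \<le> b"
  shows "UTV (cont_part x) a b = emeasure varm ({a<..b} - jumps)"
proof (rule antisym)
  have le: "UTV (cont_part x) a v \<le> ennreal (contvar v - contvar a)" if "a \<le> v" for v
  proof (rule UTV_leI[OF that])
    fix u v assume uv: "a \<le> u" "u \<le> v"
    then show "max 0 (cont_part x v - cont_part x u) \<le> contvar v - contvar u"
      using assms contvar_mono[of u v] uminus.contvar_mono[of u v] by (simp add: cont_part_eq)
  qed
  then show "UTV (cont_part x) a b \<le> emeasure varm ({a<..b} - jumps)"
    using assms by (simp add: emeasure_varm_minus_jumps)
  define W where "W v = enn2real (UTV (cont_part x) a v)" for v
  have fin: "UTV (cont_part x) a v < \<infinity>" if "a \<le> v" for v
    using le[OF that] by (auto simp: less_top[symmetric] top_unique)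
  have "cumvar b - cumvar a \<le> (W b + jumpvar b) - (W a + jumpvar a)"
  proof (rule cumvar_leI)
    show "W a + jumpvar a \<le> W b + jumpvar b"
      using jumpvar_mono[of a b] assms by (simp add: W_def add_increasing)
    fix u v assume uv: "a \<le> u" "u \<le> v" "v \<le> b"
    have "max 0 (cont_part x v - cont_part x u) \<le> W v - W u"
      unfolding W_def by (rule UTV_increment_le) (use uv fin in auto)
    then show "max 0 (x v - x u) \<le> (W v + jumpvar v) - (W u + jumpvar u)"
      using assms uv jumpvar_mono[of u v] uminus.jumpvar_mono[of u v] jordan[of u] jordan[of v]
        cumvar_split[of u] cumvar_split[of v] uminus.cumvar_split[of u] uminus.cumvar_split[of v]
      by (simp add: cont_part_eq)
  qed (use assms in auto)
  then have "contvar b - contvar a \<le> W b"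
    using assms by (simp add: cumvar_split W_def)
  then show "emeasure varm ({a<..b} - jumps) \<le> UTV (cont_part x) a b"
    using assms fin[of b] by (simp add: emeasure_varm_minus_jumps W_def ennreal_leI)
      (metis ennreal_enn2real ennreal_leI)
qed

definition contm :: "real measure" where
  "contm = density varm (indicator (- jumps))"

lemma sets_contm [simp, measurable_cong]: "sets contm = sets borel"
  and space_contm [simp]: "space contm = UNIV"
  by (simp_all add: contm_def)

lemma emeasure_contm: "A \<in> sets borel \<Longrightarrow> emeasure contm A = emeasure varm (A - jumps)"
  by (simp add: contm_def emeasure_density indicator_inter_arith[symmetric] Diff_eq Int_commute)

lemma pos_var_cont_part_eq: "pos_var (cont_part x) = restrict_space contm {0..}"
  unfolding pos_var_def
proof (rule measure_of_increments_eqI)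
  have "emeasure varm ({..0} - jumps) \<le> emeasure varm {..0}"
    by (rule emeasure_mono) auto
  then show "emeasure contm {..0} = 0"
    by (simp add: emeasure_contm emeasure_varm_nonpos)
  show "UTV (cont_part x) a b < \<infinity>" if "0 \<le> a" "a < b" for a b
    using that emeasure_varm_finite[of "{a<..b} - jumps" a b] by (simp add: UTV_cont_part)
qed (simp_all add: emeasure_contm UTV_cont_part)

end

section \<open>Chains of upcrossings\<close>

text \<open>Freely chosen times replace the hitting times, so no infimum has to be attained. The
  margin \<open>c\<close> is half the width of the crossed interval, margin 0 describes crossings of
  a single level, and the end time \<open>e\<close> is a parameter to allow induction on the last
  passage.\<close>

primrec up_chain :: "(real \<Rightarrow> real) \<Rightarrow> real \<Rightarrow> real \<Rightarrow> nat \<Rightarrow> real \<Rightarrow> bool" where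
  "up_chain x z c 0 e \<longleftrightarrow> 0 \<le> e"
| "up_chain x z c (Suc n) e \<longleftrightarrow>
     (\<exists>a b. up_chain x z c n a \<and> a \<le> b \<and> b \<le> e \<and> x a < z - c \<and> z + c < x b)"

lemma up_chain_SucI:
  "up_chain x z c n a \<Longrightarrow> a \<le> b \<Longrightarrow> b \<le> e \<Longrightarrow> x a < z - c \<Longrightarrow> z + c < x b \<Longrightarrow> up_chain x z c (Suc n) e"
  by auto

lemma up_chain_antimono: "up_chain x z c n e \<Longrightarrow> c' \<le> c \<Longrightarrow> up_chain x z c' n e"
proof (induction n arbitrary: e)
  case (Suc n)
  then obtain a b where "up_chain x z c n a" "a \<le> b" "b \<le> e" "x a < z - c" "z + c < x b" by auto
  with Suc have "up_chain x z c' n a \<and> a \<le> b \<and> b \<le> e \<and> x a < z - c' \<and> z + c' < x b" by auto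
  then show ?case by auto
qed simp

lemma up_chain_nonneg: "up_chain x z c n e \<Longrightarrow> 0 \<le> e"
  by (induction n arbitrary: e) force+

text \<open>Finitely many strict inequalities leave a common positive margin.\<close>

lemma up_chain_widen:
  assumes "up_chain x z 0 n e"
  shows "\<exists>c>0. up_chain x z c n e"
  using assms
proof (induction n arbitrary: e)
  case 0
  then show ?case by (auto intro: exI[of _ 1])
next
  case (Suc n)
  then obtain a b where ab: "up_chain x z 0 n a" "a \<le> b" "b \<le> e" "x a < z" "z < x b" by auto
  with Suc.IH obtain c where c: "c > 0" "up_chain x z c n a" by blast
  define d where "d = min c (min ((z - x a) / 2) ((x b - z) / 2))"
  have "d > 0" using c ab by (simp add: d_def)
  moreover have "up_chain x z d n a" using c(2) by (rule up_chain_antimono) (simp add: d_def)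
  moreover have "x a < z - d" "z + d < x b" using ab by (auto simp: d_def min_def field_simps)
  ultimately show ?case using ab by auto
qed

text \<open>Hitting times are the earliest choice, so by induction they never come later than the
  times of a chain. With path and level negated, \<open>tau_after\<close> waits for \<open>x\<close>
  to be at most \<open>z - c / 2\<close> and \<open>sigma_after\<close> for it to exceed
  \<open>z + c / 2\<close>.\<close>

lemma sigma_le_if_up_chain:
  assumes "up_chain x z d n e" "c \<le> 2 * d" "e \<le> t"
  shows "sigma (\<lambda>u. - x u) (- z) c 0 t n \<le> ereal e"
  using assms(1,3)
proof (induction n arbitrary: e)
  case (Suc n)
  then obtain a b where ab: "up_chain x z d n a" "a \<le> b" "b \<le> e" "x a < z - d" "z + d < x b" by auto
  let ?\<sigma> = "sigma (\<lambda>u. - x u) (- z) c 0 t n"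
  let ?\<tau> = "tau_after (\<lambda>u. - x u) (- z) c t ?\<sigma>"
  have "?\<sigma> \<le> ereal a" using ab Suc by auto
  then have "?\<tau> \<le> ereal a"
    unfolding tau_after_def using ab Suc.prems assms(2) by (intro Inf_lower) auto
  then have "?\<tau> \<le> ereal b" using ab by (auto intro: order_trans)
  then have "sigma_after (\<lambda>u. - x u) (- z) c t ?\<tau> \<le> ereal b"
    unfolding sigma_after_def using ab Suc.prems assms(2) by (intro Inf_lower) auto
  then show ?case using ab by (auto intro: order_trans)
qed simp

lemma sigma_nonneg: "0 \<le> sigma y z c 0 t n"
proof (induction n)
  case (Suc n)
  have "sigma y z c 0 t n \<le> tau_after y z c t (sigma y z c 0 t n)"
    unfolding tau_after_def by (auto intro!: Inf_greatest)
  also have "\<dots> \<le> sigma y z c 0 t (Suc n)"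
    unfolding sigma.simps sigma_after_def by (auto intro!: Inf_greatest)
  finally show ?case using Suc by (rule order_trans[rotated])
qed simp

context fv_path
begin

lemma right_cont_eventually:
  assumes "s \<ge> 0" "x s < r"
  obtains \<delta> where "\<delta> > 0" "\<And>u. s \<le> u \<Longrightarrow> u < s + \<delta> \<Longrightarrow> x u < r"
proof -
  have "eventually (\<lambda>u. x u < r) (at_right s)"
    using order_tendstoD(2)[OF right_cont[OF assms(1)] assms(2)] .
  then obtain b where b: "b > s" "\<And>u. s < u \<Longrightarrow> u < b \<Longrightarrow> x u < r"
    by (auto simp: eventually_at_right_field)
  show thesis
  proof (rule that[of "b - s"])
    fix u assume "s \<le> u" "u < s + (b - s)"
    then show "x u < r" using b(2)[of u] assms(2) by (cases "u = s") auto
  qed (use b in simp)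
qed

text \<open>The converse loses a factor in the margin: hitting times are infima, so nearby times are
  chosen at which the inequalities hold. A hitting time strictly before \<open>e\<close> has a
  witness before \<open>e\<close>; for \<open>e = t\<close> the weak inequality suffices, since
  every witness is at most \<open>t\<close>.\<close>

lemma up_chain_if_sigma:
  assumes c: "c > 0"
    and "sigma (\<lambda>u. - x u) (- z) c 0 t n < ereal e \<and> e \<le> t \<or>
      sigma (\<lambda>u. - x u) (- z) c 0 t n \<le> ereal e \<and> e = t"
  shows "up_chain x z (c / 4) n e"
  using assms(2)
proof (induction n arbitrary: e)
  case (Suc n)
  let ?\<sigma> = "sigma (\<lambda>u. - x u) (- z) c 0 t n"
  let ?\<tau> = "tau_after (\<lambda>u. - x u) (- z) c t ?\<sigma>"
  have \<sigma>: "sigma_after (\<lambda>u. - x u) (- z) c t ?\<tau> < ereal e \<and> e \<le> t \<or>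
      sigma_after (\<lambda>u. - x u) (- z) c t ?\<tau> \<le> ereal e \<and> e = t"
    using Suc.prems by simp
  have "\<exists>b. ?\<tau> \<le> ereal b \<and> b \<le> e \<and> e \<le> t \<and> z + c / 2 < x b"
    using \<sigma>
  proof
    assume *: "sigma_after (\<lambda>u. - x u) (- z) c t ?\<tau> < ereal e \<and> e \<le> t"
    then obtain b where "?\<tau> \<le> ereal b" "b \<le> t" "- x b < - z - c / 2" "ereal b < ereal e"
      unfolding sigma_after_def Inf_less_iff by auto
    with * show ?thesis by (auto intro!: exI[of _ b])
  next
    assume *: "sigma_after (\<lambda>u. - x u) (- z) c t ?\<tau> \<le> ereal e \<and> e = t"
    have "sigma_after (\<lambda>u. - x u) (- z) c t ?\<tau> < \<infinity>"
      using * by (auto intro: le_less_trans)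
    then obtain b where "?\<tau> \<le> ereal b" "b \<le> t" "- x b < - z - c / 2"
      unfolding sigma_after_def Inf_less_iff by auto
    with * show ?thesis by (auto intro!: exI[of _ b])
  qed
  then obtain b where b: "?\<tau> \<le> ereal b" "b \<le> e" "e \<le> t" "z + c / 2 < x b" by auto
  have \<sigma>_\<tau>: "?\<sigma> \<le> ?\<tau>" unfolding tau_after_def by (auto intro!: Inf_greatest)
  have b0: "0 \<le> b"
    using order_trans[OF order_trans[OF sigma_nonneg \<sigma>_\<tau>] b(1)] by simp
  \<comment> \<open>By right continuity the path exceeds \<open>z + c / 2\<close> at
    \<open>b\<close> and shortly afterwards; if \<open>?\<tau>\<close> were \<open>b\<close>, values
    at most \<open>z - c / 2\<close> would occur at \<open>b\<close> or arbitrarily soon after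
    it.\<close>
  have "?\<tau> \<noteq> ereal b"
  proof
    assume \<tau>: "?\<tau> = ereal b"
    interpret N: fv_path "\<lambda>u. - x u" by (rule fv_path_uminus)
    obtain \<delta> where \<delta>: "\<delta> > 0" "\<And>u. b \<le> u \<Longrightarrow> u < b + \<delta> \<Longrightarrow> - x u < - z - c / 2"
      using N.right_cont_eventually[of b "- z - c / 2"] b b0 by auto
    have "?\<tau> < ereal (b + \<delta>)" using \<tau> \<delta> by simp
    then obtain u where u: "?\<sigma> \<le> ereal u" "u \<le> t" "- z + c / 2 \<le> - x u" "u < b + \<delta>"
      unfolding tau_after_def Inf_less_iff by auto
    then have "?\<tau> \<le> ereal u" unfolding tau_after_def by (intro Inf_lower) auto
    then show False using \<delta>(2)[of u] u \<tau> c by simp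
  qed
  with b have "?\<tau> < ereal b" by simp
  then obtain u where u: "?\<sigma> \<le> ereal u" "u \<le> t" "- z + c / 2 \<le> - x u" "u < b"
    unfolding tau_after_def Inf_less_iff by auto
  have "0 \<le> u" using order_trans[OF sigma_nonneg u(1)] by simp
  moreover have "x u < z - c / 4" using u c by simp
  ultimately obtain \<delta> where \<delta>: "\<delta> > 0" "\<And>v. u \<le> v \<Longrightarrow> v < u + \<delta> \<Longrightarrow> x v < z - c / 4"
    using right_cont_eventually by metis
  \<comment> \<open>\<open>a\<close> lies strictly after \<open>u\<close>, hence strictly after
    \<open>?\<sigma>\<close>, as the induction hypothesis requires. The price is the drop from
    \<open>c / 2\<close> to \<open>c / 4\<close>, paid through right continuity at
    \<open>u\<close>.\<close>
  define a where "a = min ((u + b) / 2) (u + \<delta> / 2)"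
  have a: "u < a" "a < b" "a < u + \<delta>" using \<delta> u(4) by (auto simp: a_def min_def field_simps)
  have "?\<sigma> < ereal a" using u(1) a(1) by (auto intro: le_less_trans)
  then have "up_chain x z (c / 4) n a" using Suc.IH[of a] a b by auto
  moreover have "x a < z - c / 4" using \<delta>(2)[of a] a by simp
  ultimately show ?case using a b c by (intro up_chain_SucI[of x z "c / 4" n a b]) auto
qed (auto simp: less_imp_le)

text \<open>Each passage costs \<open>2 * c\<close> of positive variation. This bounds the number of
  crossings, so that the \<open>Max\<close> in \<open>downcrossings\<close> is taken over a finite
  set.\<close>

lemma up_chain_cumvar_le:
  assumes "up_chain x z c n e" "c \<ge> 0"
  shows "2 * c * real n \<le> cumvar e"
  using assms(1)
proof (induction n arbitrary: e)
  case (Suc n)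
  then obtain a b where ab: "up_chain x z c n a" "a \<le> b" "b \<le> e" "x a < z - c" "z + c < x b" by auto
  have "2 * c * real n \<le> cumvar a" using ab Suc.IH by blast
  then show ?case
    using cumvar_increment[OF up_chain_nonneg[OF ab(1)] ab(2)] cumvar_mono[OF ab(3)] ab
    by (simp add: algebra_simps)
qed (simp add: cumvar_nonneg)

lemma finite_sigma:
  assumes "c > 0"
  shows "finite {n. sigma (\<lambda>u. - x u) (- z) c 0 t n \<le> ereal t}"
proof (rule finite_subset)
  show "{n. sigma (\<lambda>u. - x u) (- z) c 0 t n \<le> ereal t} \<subseteq> {n. real n \<le> cumvar t / (c / 2)}"
  proof safe
    fix n assume "sigma (\<lambda>u. - x u) (- z) c 0 t n \<le> ereal t"
    then have "2 * (c / 4) * real n \<le> cumvar t"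
      using up_chain_if_sigma[OF assms, of z t n t] up_chain_cumvar_le[of z "c/4" n t] assms by auto
    then show "real n \<le> cumvar t / (c / 2)" using assms by (simp add: field_simps)
  qed
  have "{n. real n \<le> cumvar t / (c / 2)} \<subseteq> {..nat \<lfloor>cumvar t / (c / 2)\<rfloor>}"
    by (auto simp: le_nat_floor)
  then show "finite {n. real n \<le> cumvar t / (c / 2)}" by (rule finite_subset) simp
qed

lemma upcrossings_ge:
  assumes "c > 0" "up_chain x z d n t" "c \<le> 2 * d"
  shows "n \<le> upcrossings z c x 0 t"
  unfolding upcrossings_def downcrossings_def
  using finite_sigma[OF assms(1)] sigma_le_if_up_chain[OF assms(2,3) order_refl] by (intro Max_ge) auto

lemma up_chain_upcrossings:
  assumes "c > 0" "t \<ge> 0"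
  shows "up_chain x z (c / 4) (upcrossings z c x 0 t) t"
proof -
  have "upcrossings z c x 0 t \<in> {n. sigma (\<lambda>u. - x u) (- z) c 0 t n \<le> ereal t}"
    unfolding upcrossings_def downcrossings_def
  proof (rule Max_in[OF finite_sigma[OF assms(1)]])
    have "sigma (\<lambda>u. - x u) (- z) c 0 t 0 \<le> ereal t" using assms by simp
    then show "{n. sigma (\<lambda>u. - x u) (- z) c 0 t n \<le> ereal t} \<noteq> {}" by blast
  qed
  then show ?thesis using up_chain_if_sigma[OF assms(1), of z t _ t] by auto
qed

text \<open>Eliminates the hitting times: a chain of margin 0 has some positive margin and is
  therefore counted for all small \<open>c\<close>, while every count yields a chain of the same
  length.\<close>

lemma level_up_eq_Sup:
  assumes "t \<ge> 0"
  shows "level_up z x 0 t = Sup (enat ` {n. up_chain x z 0 n t})" (is "_ = ?S")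
  unfolding level_up_def
proof (intro tendsto_Lim order_tendstoI)
  fix r assume "r < ?S"
  then obtain n where n: "up_chain x z 0 n t" "r < enat n"
    by (auto simp: less_Sup_iff)
  from up_chain_widen[OF n(1)] obtain d where d: "d > 0" "up_chain x z d n t" by auto
  show "eventually (\<lambda>c. r < enat (upcrossings z c x 0 t)) (at_right 0)"
    unfolding eventually_at_right_field
  proof (intro exI[of _ d] conjI allI impI)
    fix c assume "0 < c" "c < d"
    then have "n \<le> upcrossings z c x 0 t" using d by (intro upcrossings_ge[OF _ d(2)]) auto
    then show "r < enat (upcrossings z c x 0 t)" using n(2) by (auto intro: less_le_trans)
  qed (use d in auto)
next
  fix r assume r: "?S < r"
  have "enat (upcrossings z c x 0 t) \<le> ?S" if "c > 0" for c
    using up_chain_antimono[OF up_chain_upcrossings[OF that assms, of z], of 0] that by (intro Sup_upper) auto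
  then show "eventually (\<lambda>c. enat (upcrossings z c x 0 t) < r) (at_right 0)"
    using r unfolding eventually_at_right_field by (intro exI[of _ 1]) (auto intro: le_less_trans)
qed simp

end

text \<open>The latest of the intervals becomes the last passage of the chain.\<close>

lemma up_chain_card:
  assumes "finite S" "0 \<le> e"
    and "\<And>u v. (u, v) \<in> S \<Longrightarrow> 0 \<le> u \<and> u < v \<and> v \<le> e \<and> x u < z \<and> z < x v"
    and "\<And>u v u' v'. (u, v) \<in> S \<Longrightarrow> (u', v') \<in> S \<Longrightarrow> (u, v) \<noteq> (u', v') \<Longrightarrow> v \<le> u' \<or> v' \<le> u"
  shows "up_chain x z 0 (card S) e"
  using assms
proof (induction "card S" arbitrary: S e)
  case (Suc n)
  then have "finite (fst ` S)" "fst ` S \<noteq> {}" by auto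
  from Max_in[OF this] obtain u v where uv: "(u, v) \<in> S" "u = Max (fst ` S)" by force
  have max: "u' \<le> u" if "(u', v') \<in> S" for u' v'
    unfolding uv(2) using that Suc.prems(1) by (intro Max_ge) force+
  have card: "card (S - {(u, v)}) = n" using Suc uv by simp
  have "up_chain x z 0 n u"
    unfolding card[symmetric]
  proof (rule Suc.hyps(1))
    fix u' v' assume *: "(u', v') \<in> S - {(u, v)}"
    then have "v' \<le> u"
      using Suc.prems(4)[of u' v' u v] Suc.prems(3)[of u v] uv max[of u' v'] by fastforce
    then show "0 \<le> u' \<and> u' < v' \<and> v' \<le> u \<and> x u' < z \<and> z < x v'"
      using * Suc.prems(3)[of u' v'] by auto
  next
    show "\<And>u' v' u'' v''. (u', v') \<in> S - {(u, v)} \<Longrightarrow> (u'', v'') \<in> S - {(u, v)} \<Longrightarrow>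
        (u', v') \<noteq> (u'', v'') \<Longrightarrow> v' \<le> u'' \<or> v'' \<le> u'"
      using Suc.prems(4) by blast
  qed (use Suc card uv in auto)
  then show ?case
    unfolding Suc.hyps(2)[symmetric] using Suc.prems(3)[OF uv(1)] by (intro up_chain_SucI[of x z 0 n u v]) auto
qed simp

section \<open>Crossings along partitions\<close>

lemma discrete_switch:
  fixes i j :: nat
  assumes "i \<le> j" "P i" "\<not> P j"
  shows "\<exists>k\<ge>i. k < j \<and> P k \<and> \<not> P (Suc k)"
  using assms
proof (induction j rule: dec_induct)
  case (step j)
  then show ?case by (cases "P j") (auto intro: less_SucI)
qed simp

definition grid :: "real \<Rightarrow> nat \<Rightarrow> nat \<Rightarrow> real" where
  "grid t N k = t * real k / real (Suc N)"

text \<open>Rounds up: \<open>x\<close> is only right continuous, so a time has to be approximated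
  by grid points at or after it.\<close>

definition grid_index :: "real \<Rightarrow> nat \<Rightarrow> real \<Rightarrow> nat" where
  "grid_index t N s = nat \<lceil>s * real (Suc N) / t\<rceil>"

lemma grid_mono: "t > 0 \<Longrightarrow> k \<le> l \<Longrightarrow> grid t N k \<le> grid t N l"
  by (simp add: grid_def divide_right_mono mult_left_mono)

lemma grid_Suc [simp]: "grid t N (Suc N) = t"
  and grid_0 [simp]: "grid t N 0 = 0"
  by (simp_all add: grid_def)

lemma grid_index_mono: "t > 0 \<Longrightarrow> a \<le> b \<Longrightarrow> grid_index t N a \<le> grid_index t N b"
  unfolding grid_index_def by (intro nat_mono ceiling_mono divide_right_mono mult_right_mono) auto

lemma grid_index_end [simp]:
  assumes "t > 0"
  shows "grid_index t N t = Suc N"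
proof -
  have "t * real (Suc N) / t = real (Suc N)" using assms by simp
  then show ?thesis unfolding grid_index_def by (simp only: ceiling_of_nat nat_int)
qed

lemma grid_grid_index:
  assumes "t > 0" "s \<ge> 0"
  shows "s \<le> grid t N (grid_index t N s)" "grid t N (grid_index t N s) \<le> s + t / real (Suc N)"
proof -
  let ?r = "s * real (Suc N) / t"
  have "?r \<ge> 0" using assms by simp
  then have eq: "real (grid_index t N s) = of_int \<lceil>?r\<rceil>"
    unfolding grid_index_def by (intro of_nat_nat) simp
  have 1: "?r \<le> of_int \<lceil>?r\<rceil>" "of_int \<lceil>?r\<rceil> \<le> ?r + 1" by linarith+
  have t: "t / real (Suc N) \<ge> 0" using assms by simp
  have g: "grid t N (grid_index t N s) = t / real (Suc N) * of_int \<lceil>?r\<rceil>"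
    by (simp add: grid_def eq)
  have s: "s = t / real (Suc N) * ?r" using assms by simp
  show "s \<le> grid t N (grid_index t N s)"
    unfolding g by (subst s, rule mult_left_mono[OF 1(1) t])
  have "t / real (Suc N) * of_int \<lceil>?r\<rceil> \<le> t / real (Suc N) * (?r + 1)"
    by (rule mult_left_mono[OF 1(2) t])
  also have "\<dots> = s + t / real (Suc N)" using s by (simp only: distrib_left mult_1_right)
  finally show "grid t N (grid_index t N s) \<le> s + t / real (Suc N)" unfolding g .
qed

context fv_path
begin

lemma eventually_grid_less:
  assumes "t > 0" "s \<ge> 0" "x s < z"
  shows "eventually (\<lambda>N. x (grid t N (grid_index t N s)) < z) sequentially"
proof -
  obtain \<delta> where \<delta>: "\<delta> > 0" "\<And>u. s \<le> u \<Longrightarrow> u < s + \<delta> \<Longrightarrow> x u < z"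
    using right_cont_eventually[OF assms(2,3)] by blast
  have "(\<lambda>N. t / real (Suc N)) \<longlonglongrightarrow> 0"
    by (rule LIMSEQ_Suc[OF lim_const_over_n])
  from order_tendstoD(2)[OF this \<delta>(1)] show ?thesis
  proof eventually_elim
    case (elim N)
    then show ?case using grid_grid_index[OF assms(1,2), of N] by (intro \<delta>(2)) auto
  qed
qed

end

context fv_path
begin

interpretation uminus: fv_path "\<lambda>s. - x s"
  by (rule fv_path_uminus)

text \<open>For a passage from \<open>a\<close> to \<open>b\<close> the grid points just after
  \<open>a\<close> and \<open>b\<close> eventually lie on opposite sides of \<open>z\<close>, so two
  neighbouring grid points in between change side; a level that is no grid value makes this change
  strict.\<close>

lemma eventually_grid_count:
  assumes "t > 0" "up_chain x z 0 n e" "e \<le> t"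
    and z: "\<And>N k. x (grid t N k) \<noteq> z"
  shows "eventually (\<lambda>N. n \<le> card {k. k < grid_index t N e \<and> x (grid t N k) < z \<and> z < x (grid t N (Suc k))}) sequentially"
    (is "eventually (\<lambda>N. n \<le> card (?C N e)) _")
  using assms(2,3)
proof (induction n arbitrary: e)
  case (Suc n)
  let ?C = "\<lambda>N e. {k. k < grid_index t N e \<and> x (grid t N k) < z \<and> z < x (grid t N (Suc k))}"
  from Suc.prems obtain a b where ab: "up_chain x z 0 n a" "a \<le> b" "b \<le> e" "x a < z" "z < x b" by auto
  have "0 \<le> a" by (rule up_chain_nonneg[OF ab(1)])
  have "eventually (\<lambda>N. n \<le> card (?C N a)) sequentially"
    using Suc.IH[of a] ab Suc.prems by auto
  moreover have "eventually (\<lambda>N. x (grid t N (grid_index t N a)) < z) sequentially"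
    using eventually_grid_less[OF assms(1) \<open>0 \<le> a\<close> ab(4)] .
  moreover have "eventually (\<lambda>N. - x (grid t N (grid_index t N b)) < - z) sequentially"
    using \<open>0 \<le> a\<close> ab by (intro uminus.eventually_grid_less[OF assms(1)]) auto
  ultimately show ?case
  proof eventually_elim
    case (elim N)
    obtain k where k: "k \<ge> grid_index t N a" "k < grid_index t N b" "x (grid t N k) < z" "\<not> x (grid t N (Suc k)) < z"
      using discrete_switch[of "grid_index t N a" "grid_index t N b" "\<lambda>k. x (grid t N k) < z"]
        grid_index_mono[OF assms(1) ab(2), of N] elim by auto
    have "k < grid_index t N e" using k grid_index_mono[OF assms(1) ab(3), of N] by simp
    then have "insert k (?C N a) \<subseteq> ?C N e"
      using k z[of N "Suc k"] grid_index_mono[OF assms(1) order_trans[OF ab(2,3)], of N] by auto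
    then have "card (insert k (?C N a)) \<le> card (?C N e)"
      by (intro card_mono) auto
    \<comment> \<open>The cell \<open>k\<close> starts at or after the grid index of
      \<open>a\<close>, so it is not among those already counted.\<close>
    moreover have "card (insert k (?C N a)) = Suc (card (?C N a))"
      using k by (intro card_insert_disjoint) auto
    ultimately show ?case using elim by simp
  qed
qed simp

end

section \<open>Integrating crossing counts over the levels\<close>

definition level_up_count :: "(real \<Rightarrow> real) \<Rightarrow> real \<Rightarrow> real \<Rightarrow> ennreal" where
  "level_up_count x t z = ennreal_of_enat (level_up z x 0 t)"

lemma sum_indicator_eq_card:
  "finite I \<Longrightarrow> (\<Sum>i\<in>I. indicator (B i) z :: ennreal) = of_nat (card {i\<in>I. z \<in> B i})"
  by (simp add: indicator_def sum.If_cases Int_def)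

context fv_path
begin

text \<open>Non-overlapping intervals along which the path rises past \<open>z\<close> are the
  passages of one chain. Such intervals have positive length, so distinct indices give distinct
  passages.\<close>

lemma sum_indicator_le_level_up_count:
  assumes "finite I" "t \<ge> 0"
    and I: "\<And>i. i \<in> I \<Longrightarrow> 0 \<le> u i \<and> u i \<le> v i \<and> v i \<le> t"
    and disj: "\<And>i j. i \<in> I \<Longrightarrow> j \<in> I \<Longrightarrow> i \<noteq> j \<Longrightarrow> v i \<le> u j \<or> v j \<le> u i"
  shows "(\<Sum>i\<in>I. indicator {x (u i)<..<x (v i)} z) \<le> level_up_count x t z"
proof -
  define J where "J = {i\<in>I. z \<in> {x (u i)<..<x (v i)}}"
  have J: "u i < v i" if "i \<in> J" for i
    using I[of i] that by (cases "u i = v i") (auto simp: J_def)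
  have "inj_on (\<lambda>i. (u i, v i)) J"
  proof (rule inj_onI, rule ccontr)
    fix i j assume ij: "i \<in> J" "j \<in> J" "(u i, v i) = (u j, v j)" "i \<noteq> j"
    then have "v i \<le> u j \<or> v j \<le> u i" by (intro disj) (auto simp: J_def)
    then show False using J[OF ij(1)] ij(3) by auto
  qed
  then have "card J = card ((\<lambda>i. (u i, v i)) ` J)" by (simp add: card_image)
  moreover have "up_chain x z 0 (card ((\<lambda>i. (u i, v i)) ` J)) t"
  proof (rule up_chain_card)
    show "finite ((\<lambda>i. (u i, v i)) ` J)" using assms(1) by (simp add: J_def)
    fix a b assume "(a, b) \<in> (\<lambda>i. (u i, v i)) ` J"
    then obtain i where i: "i \<in> J" "a = u i" "b = v i" by auto
    then show "0 \<le> a \<and> a < b \<and> b \<le> t \<and> x a < z \<and> z < x b"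
      using J[OF i(1)] I[of i] by (auto simp: J_def)
    fix a' b' assume "(a', b') \<in> (\<lambda>i. (u i, v i)) ` J"
    then obtain j where j: "j \<in> J" "a' = u j" "b' = v j" by auto
    assume "(a, b) \<noteq> (a', b')"
    then have "i \<noteq> j" using i j by auto
    then show "b \<le> a' \<or> b' \<le> a" using disj[of i j] i j by (auto simp: J_def)
  qed fact
  ultimately have "enat (card J) \<le> level_up z x 0 t"
    unfolding level_up_eq_Sup[OF assms(2)] by (intro Sup_upper) auto
  then have "ennreal_of_enat (enat (card J)) \<le> level_up_count x t z"
    unfolding level_up_count_def by (simp only: ennreal_of_enat_le_iff)
  then show ?thesis
    using assms(1) by (simp add: sum_indicator_eq_card J_def)
qed

definition grid_count :: "real \<Rightarrow> nat \<Rightarrow> real \<Rightarrow> ennreal" where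
  "grid_count t N z = (\<Sum>k<Suc N. indicator {x (grid t N k)<..<x (grid t N (Suc k))} z)"

lemma grid_count_le:
  assumes "t > 0"
  shows "grid_count t N z \<le> level_up_count x t z"
  unfolding grid_count_def
proof (rule sum_indicator_le_level_up_count)
  fix k assume "k \<in> {..<Suc N}"
  then show "0 \<le> grid t N k \<and> grid t N k \<le> grid t N (Suc k) \<and> grid t N (Suc k) \<le> t"
    using grid_mono[OF assms, of 0 k N] grid_mono[OF assms, of k "Suc k" N] grid_mono[OF assms, of "Suc k" "Suc N" N]
    by simp
next
  fix k l :: nat assume "k \<noteq> l"
  then show "grid t N (Suc k) \<le> grid t N l \<or> grid t N (Suc l) \<le> grid t N k"
    using grid_mono[OF assms, of "Suc k" l N] grid_mono[OF assms, of "Suc l" k N] by (cases "k < l") auto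
qed (use assms in auto)

lemma level_up_count_le_liminf:
  assumes "t > 0" "\<And>N k. x (grid t N k) \<noteq> z"
  shows "level_up_count x t z \<le> liminf (\<lambda>N. grid_count t N z)"
  unfolding level_up_count_def level_up_eq_Sup[OF less_imp_le[OF assms(1)]] ennreal_of_enat_Sup
proof (rule SUP_least, safe)
  fix n assume "up_chain x z 0 n t"
  from eventually_grid_count[OF assms(1) this order_refl assms(2)]
  have "eventually (\<lambda>N. of_nat n \<le> grid_count t N z) sequentially"
  proof eventually_elim
    case (elim N)
    then show ?case
      using assms(1) unfolding grid_count_def
      by (subst sum_indicator_eq_card) (auto simp: Collect_conj_eq lessThan_def)
  qed
  then show "ennreal_of_enat (enat n) \<le> liminf (\<lambda>N. grid_count t N z)"
    by (simp add: Liminf_bounded)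
qed

lemma countable_grid_values: "countable {z. \<exists>N k. x (grid t N k) = z}"
proof -
  have "{z. \<exists>N k. x (grid t N k) = z} = (\<lambda>(N, k). x (grid t N k)) ` UNIV" by auto
  then show ?thesis by simp
qed

lemma measurable_grid_count [measurable]: "grid_count t N \<in> borel_measurable borel"
  unfolding grid_count_def[abs_def] by measurable

text \<open>Off the countable set of grid values the count is the lower limit of the grid counts,
  which are step functions.\<close>

lemma measurable_level_up_count:
  assumes "t > 0"
  shows "level_up_count x t \<in> borel_measurable borel"
proof (rule measurable_discrete_difference[OF _ countable_grid_values[of t]])
  show "(\<lambda>z. liminf (\<lambda>N. grid_count t N z)) \<in> borel_measurable borel" by measurable
  fix z assume "z \<notin> {z. \<exists>N k. x (grid t N k) = z}"
  then have "level_up_count x t z \<le> liminf (\<lambda>N. grid_count t N z)"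
    using level_up_count_le_liminf[OF assms, of z] by auto
  moreover have "liminf (\<lambda>N. grid_count t N z) \<le> level_up_count x t z"
    using grid_count_le[OF assms, of _ z]
    by (intro order_trans[OF Liminf_le_Limsup] Limsup_bounded) auto
  ultimately show "liminf (\<lambda>N. grid_count t N z) = level_up_count x t z" by simp
qed auto

text \<open>The levels passed upward from \<open>x u\<close> to \<open>x v\<close> form an interval
  of length \<open>max 0 (x v - x u)\<close>, so a division sum is the integral of a count of
  passages.\<close>

lemma UTV_le_nn_integral_level_up_count:
  assumes "t > 0"
  shows "UTV x 0 t \<le> (\<integral>\<^sup>+z. level_up_count x t z \<partial>lborel)"
  unfolding UTV_def variation_def
proof (rule SUP_least, safe)
  fix p assume p: "p division_of {0..t}"
  \<comment> \<open>Degenerate cells contribute nothing but may lie inside another cell; without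
    them the cells are ordered along the line.\<close>
  define I where "I = {K\<in>p. Inf K < Sup K}"
  have fin: "finite p" by (rule division_ofD(1)[OF p])
  have leb: "(\<integral>\<^sup>+z. indicator {a<..<b} z \<partial>lborel) = ennreal (max 0 (b - a))" for a b :: real
    by (cases "a \<le> b") (auto simp: max_def)
  have "(\<Sum>K\<in>p. ennreal (max 0 (x (Sup K) - x (Inf K)))) = (\<Sum>K\<in>I. ennreal (max 0 (x (Sup K) - x (Inf K))))"
  proof (rule sum.mono_neutral_right[OF fin])
    show "\<forall>K\<in>p - I. ennreal (max 0 (x (Sup K) - x (Inf K))) = 0"
    proof
      fix K assume "K \<in> p - I"
      then have "Inf K = Sup K" by (auto simp: I_def elim!: division_of_realE[OF p])
      then show "ennreal (max 0 (x (Sup K) - x (Inf K))) = 0" by simp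
    qed
  qed (auto simp: I_def)
  also have "\<dots> = (\<integral>\<^sup>+z. (\<Sum>K\<in>I. indicator {x (Inf K)<..<x (Sup K)} z) \<partial>lborel)"
    by (simp add: nn_integral_sum leb)
  also have "\<dots> \<le> (\<integral>\<^sup>+z. level_up_count x t z \<partial>lborel)"
  proof (intro nn_integral_mono sum_indicator_le_level_up_count)
    show "finite I" using fin by (simp add: I_def)
    fix K assume K: "K \<in> I"
    then have "K \<in> p" by (simp add: I_def)
    then show "0 \<le> Inf K \<and> Inf K \<le> Sup K \<and> Sup K \<le> t"
      by (auto elim!: division_of_realE[OF p])
    fix L assume L: "L \<in> I" "K \<noteq> L"
    then have "interior K \<inter> interior L = {}"
      using division_ofD(5)[OF p] K by (auto simp: I_def)
    moreover have "interior K = {Inf K<..<Sup K}" "interior L = {Inf L<..<Sup L}"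
      using K L by (auto simp: I_def elim!: division_of_realE[OF p])
    \<comment> \<open>If the cells overlapped, the midpoint of the overlap would belong to both
      interiors.\<close>
    ultimately have "(max (Inf K) (Inf L) + min (Sup K) (Sup L)) / 2 \<notin> {Inf K<..<Sup K} \<inter> {Inf L<..<Sup L}"
      by simp
    then show "Sup K \<le> Inf L \<or> Sup L \<le> Inf K"
      using K L by (auto simp: I_def max_def min_def field_simps split: if_splits)
  qed (use assms in simp)
  finally show "(\<Sum>K\<in>p. ennreal (max 0 (x (Sup K) - x (Inf K)))) \<le> (\<integral>\<^sup>+z. level_up_count x t z \<partial>lborel)" .
qed

text \<open>\<open>G\<close> is a primitive of the indicator of \<open>A\<close>, so a grid count
  integrated over \<open>A\<close> is a sum of positive increments of \<open>G \<circ> x\<close>.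
  Fatou's lemma passes to the level count, which for almost every level is at most the lower limit
  of the grid counts.\<close>

lemma nn_integral_level_up_count_le:
  assumes "t > 0" and A [measurable]: "A \<in> sets borel"
    and G: "mono G" "\<And>u v. \<bar>G u - G v\<bar> \<le> \<bar>u - v\<bar>"
    and leb: "\<And>u v. u \<le> v \<Longrightarrow> emeasure lborel (A \<inter> {u<..<v}) = ennreal (G v - G u)"
    and Gx: "fv_path (\<lambda>s. G (x s))"
  shows "(\<integral>\<^sup>+z\<in>A. level_up_count x t z \<partial>lborel) \<le> UTV (\<lambda>s. G (x s)) 0 t"
proof -
  interpret G: fv_path "\<lambda>s. G (x s)" by (rule Gx)
  have step: "emeasure lborel (A \<inter> {u<..<v}) = ennreal (max 0 (G v - G u))" for u v
    using leb[of u v] monoD[OF G(1), of v u] monoD[OF G(1), of u v] by (cases "u \<le> v") (auto simp: max_def)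
  have "AE z in lborel. z \<notin> {z. \<exists>N k. x (grid t N k) = z}"
    by (intro AE_not_in countable_imp_null_set_lborel countable_grid_values)
  then have "(\<integral>\<^sup>+z\<in>A. level_up_count x t z \<partial>lborel) \<le> (\<integral>\<^sup>+z. liminf (\<lambda>N. grid_count t N z * indicator A z) \<partial>lborel)"
    using level_up_count_le_liminf[OF assms(1)]
    by (intro nn_integral_mono_AE) (auto simp: indicator_def)
  also have "\<dots> \<le> liminf (\<lambda>N. \<integral>\<^sup>+z. grid_count t N z * indicator A z \<partial>lborel)"
    by (intro nn_integral_liminf) measurable
  also have "\<dots> \<le> UTV (\<lambda>s. G (x s)) 0 t"
  proof (intro order_trans[OF Liminf_le_Limsup] Limsup_bounded always_eventually allI)
    fix N
    have "grid_count t N z * indicator A z = (\<Sum>k<Suc N. indicator (A \<inter> {x (grid t N k)<..<x (grid t N (Suc k))}) z)" for z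
      unfolding grid_count_def sum_distrib_right by (intro sum.cong refl) (auto simp: indicator_def)
    then have "(\<integral>\<^sup>+z. grid_count t N z * indicator A z \<partial>lborel)
      = (\<integral>\<^sup>+z. (\<Sum>k<Suc N. indicator (A \<inter> {x (grid t N k)<..<x (grid t N (Suc k))}) z) \<partial>lborel)"
      by (intro nn_integral_cong)
    also have "\<dots> = (\<Sum>k<Suc N. \<integral>\<^sup>+z. indicator (A \<inter> {x (grid t N k)<..<x (grid t N (Suc k))}) z \<partial>lborel)"
      by (rule nn_integral_sum) measurable
    also have "\<dots> = (\<Sum>k<Suc N. ennreal (max 0 (G (x (grid t N (Suc k))) - G (x (grid t N k)))))"
      by (intro sum.cong refl) (simp add: step)
    also have "\<dots> \<le> (\<Sum>k<Suc N. ennreal (G.cumvar (grid t N (Suc k)) - G.cumvar (grid t N k)))"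
      using grid_mono[OF assms(1), of 0 _ N] grid_mono[OF assms(1), of _ "Suc _" N]
      by (intro sum_mono ennreal_leI G.cumvar_increment) auto
    also have "\<dots> = ennreal (\<Sum>k<Suc N. G.cumvar (grid t N (Suc k)) - G.cumvar (grid t N k))"
      using grid_mono[OF assms(1), of _ "Suc _" N] by (intro sum_ennreal) (auto intro: G.cumvar_mono)
    also have "\<dots> = ennreal (G.cumvar t)"
      using sum_lessThan_telescope[of "\<lambda>k. G.cumvar (grid t N k)" "Suc N"] by (simp del: sum.lessThan_Suc)
    finally show "(\<integral>\<^sup>+z. grid_count t N z * indicator A z \<partial>lborel) \<le> UTV (\<lambda>s. G (x s)) 0 t"
      using assms(1) by (simp add: G.ennreal_cumvar)
  qed simp
  finally show ?thesis .
qed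

end

section \<open>The occupation measure\<close>

lemma affine_mem_segment_iff:
  fixes l r :: real
  assumes "l < r"
  shows "l + (r - l) * \<theta> \<in> {l<..<r} \<longleftrightarrow> \<theta> \<in> {0<..<1}"
proof -
  have "l + (r - l) * \<theta> < r \<longleftrightarrow> (r - l) * \<theta> < (r - l) * 1" by (simp only: mult_1_right) linarith
  then show ?thesis using assms by (simp add: zero_less_mult_iff)
qed

lemma nn_integral_segment:
  fixes l r :: real
  assumes "l < r" and [measurable]: "f \<in> borel_measurable borel"
  shows "(\<integral>\<^sup>+\<theta>\<in>{0<..<1}. f (l + \<theta> * (r - l)) \<partial>lborel) * ennreal (r - l) = (\<integral>\<^sup>+z\<in>{l<..<r}. f z \<partial>lborel)"
proof -
  have "(\<integral>\<^sup>+z\<in>{l<..<r}. f z \<partial>lborel)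
      = ennreal \<bar>r - l\<bar> * (\<integral>\<^sup>+\<theta>. f (l + (r - l) * \<theta>) * indicator {l<..<r} (l + (r - l) * \<theta>) \<partial>lborel)"
    using assms(1) by (subst nn_integral_real_affine[where c="r - l" and t=l]) auto
  also have "(\<lambda>\<theta>. f (l + (r - l) * \<theta>) * indicator {l<..<r} (l + (r - l) * \<theta>)) = (\<lambda>\<theta>. f (l + \<theta> * (r - l)) * indicator {0<..<1} \<theta>)"
    unfolding indicator_def affine_mem_segment_iff[OF assms(1)] by (simp add: mult.commute)
  finally show ?thesis using assms(1) by (simp add: mult.commute)
qed

text \<open>Domination on intervals extends to Borel sets because the difference of the cumulative
  functions is again monotone and right continuous: it generates a measure \<open>H\<close>, and
  \<open>varm\<close> plus \<open>H\<close> is the variation measure of \<open>y\<close>.\<close>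

lemma (in fv_path) emeasure_varm_mono:
  assumes "fv_path y" "\<And>a b. 0 \<le> a \<Longrightarrow> a \<le> b \<Longrightarrow> UTV x a b \<le> UTV y a b"
    and B: "B \<in> sets borel"
  shows "emeasure varm B \<le> emeasure (fv_path.varm y) B"
proof -
  interpret Y: fv_path y by fact
  define F where "F s = Y.cumvar s - cumvar s" for s
  have F_mono: "F a \<le> F b" if "a \<le> b" for a b
  proof (cases "a < 0")
    case True
    have "cumvar b \<le> Y.cumvar b"
      using assms(2)[of 0 b] by (simp add: cumvar_def Y.cumvar_def enn2real_mono Y.UTV_finite[unfolded infinity_ennreal_def])
    then show ?thesis using True by (simp add: F_def)
  next
    case False
    then have "ennreal (cumvar b - cumvar a) \<le> ennreal (Y.cumvar b - Y.cumvar a)"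
      using assms(2)[of a b] that by (simp add: UTV_eq_cumvar Y.UTV_eq_cumvar)
    then show ?thesis using Y.cumvar_mono[OF that] by (simp add: F_def)
  qed
  have F_cont: "continuous (at_right a) F" for a
    unfolding F_def continuous_within by (intro tendsto_intros cumvar_right_cont Y.cumvar_right_cont)
  define H where "H = interval_measure F"
  have sets_H: "sets H = sets borel" and space_H: "space H = UNIV" by (simp_all add: H_def)
  have H: "emeasure H {a<..b} = ennreal (F b - F a)" if "a \<le> b" for a b
    unfolding H_def by (rule emeasure_interval_measure_Ioc[OF that F_mono F_cont])
  define S where "S = measure_of UNIV (sets borel) (\<lambda>B. emeasure varm B + emeasure H B)"
  have sets_S: "sets S = sets borel"
    unfolding S_def using sets.sigma_sets_eq[of borel] by (subst sets_measure_of) auto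
  have S: "emeasure S B = emeasure varm B + emeasure H B" if "B \<in> sets borel" for B
  proof (rule emeasure_measure_of[OF S_def])
    show "countably_additive (sets S) (\<lambda>B. emeasure varm B + emeasure H B)"
    proof (rule countably_additiveI)
      fix A :: "nat \<Rightarrow> real set"
      assume A: "range A \<subseteq> sets S" "disjoint_family A"
      have "(\<Sum>i. emeasure varm (A i) + emeasure H (A i)) = (\<Sum>i. emeasure varm (A i)) + (\<Sum>i. emeasure H (A i))"
        by (rule suminf_add[symmetric]) auto
      also have "\<dots> = emeasure varm (\<Union>i. A i) + emeasure H (\<Union>i. A i)"
        using A sets_S sets_H by (simp add: suminf_emeasure)
      finally show "(\<Sum>i. emeasure varm (A i) + emeasure H (A i)) = emeasure varm (\<Union>i. A i) + emeasure H (\<Union>i. A i)" .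
    qed
  qed (use that sets_S in \<open>auto simp: positive_def\<close>)
  have "S = Y.varm"
  proof (rule measure_eqI_Ioc[OF sets_S Y.sets_varm])
    fix a b
    show "emeasure S {a<..b} = emeasure Y.varm {a<..b}"
    proof (cases "a \<le> b")
      case True
      then show ?thesis
        using F_mono[OF True] cumvar_mono[OF True]
        by (simp add: S emeasure_varm_Ioc H Y.emeasure_varm_Ioc F_def flip: ennreal_plus)
    qed (simp add: S)
    show "emeasure Y.varm {a<..b} < \<infinity>" by (rule Y.emeasure_varm_finite) auto
  qed
  then show ?thesis using S[OF B] by simp
qed

definition unit_uniform :: "real measure" where
  "unit_uniform = density lborel (indicator {0<..<1})"

lemma sets_unit_uniform [simp, measurable_cong]: "sets unit_uniform = sets borel"
  and space_unit_uniform [simp]: "space unit_uniform = UNIV"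
  by (simp_all add: unit_uniform_def)

lemma emeasure_unit_uniform: "emeasure unit_uniform UNIV = 1"
  by (simp add: unit_uniform_def emeasure_density)

lemma finite_measure_unit_uniform: "finite_measure unit_uniform"
  by standard (simp add: emeasure_unit_uniform)

context fv_path
begin

interpretation uminus: fv_path "\<lambda>s. - x s"
  by (rule fv_path_uminus)

text \<open>Borel functions on the whole line that agree with \<open>x\<close> and \<open>left_lim x\<close> at positive times.\<close>

definition path_ext :: "real \<Rightarrow> real" where
  "path_ext s = x 0 + cumvar s - fv_path.cumvar (\<lambda>u. - x u) s"

definition left_ext :: "real \<Rightarrow> real" where
  "left_ext s = path_ext s - (if s \<in> jumps then jump x s else 0)"

lemma path_ext_eq: "s \<ge> 0 \<Longrightarrow> path_ext s = x s"
  using jordan[of s] by (simp add: path_ext_def)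

lemma left_ext_eq: "s > 0 \<Longrightarrow> left_ext s = left_lim x s"
  by (auto simp: left_ext_def path_ext_eq jump_def jumps_def)

lemma path_ext_diff: "path_ext s - left_ext s = (if s \<in> jumps then jump x s else 0)"
  by (simp add: left_ext_def)

lemma measurable_path_ext [measurable]: "path_ext \<in> borel_measurable borel"
proof -
  have [measurable]: "cumvar \<in> borel_measurable borel" "uminus.cumvar \<in> borel_measurable borel"
    by (auto intro!: borel_measurable_mono monoI cumvar_mono uminus.cumvar_mono)
  show ?thesis unfolding path_ext_def[abs_def] by measurable
qed

lemma measurable_left_ext [measurable]: "left_ext \<in> borel_measurable borel"
proof -
  have [measurable]: "(\<lambda>s. if s \<in> jumps then jump x s else 0) \<in> borel_measurable borel"
    by (rule measurable_discrete_difference[of "\<lambda>_. 0" _ _ jumps]) (auto simp: countable_jumps)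
  show ?thesis unfolding left_ext_def[abs_def] by measurable
qed

text \<open>The point at fraction \<open>\<theta>\<close> of a jump. Off \<open>jumps\<close> it
  does not depend on \<open>\<theta>\<close>, so jumps and continuous motion are covered by one
  formula.\<close>

definition jump_segment :: "real \<Rightarrow> real \<Rightarrow> real" where
  "jump_segment s \<theta> = left_ext s + \<theta> * (path_ext s - left_ext s)"

lemma measurable_jump_segment [measurable]: "case_prod jump_segment \<in> borel_measurable (borel \<Otimes>\<^sub>M borel)"
  unfolding jump_segment_def[abs_def] by measurable

definition stopped :: "real \<Rightarrow> real measure" where
  "stopped t = density varm (indicator {0<..t})"

lemma sets_stopped [simp, measurable_cong]: "sets (stopped t) = sets borel"
  and space_stopped [simp]: "space (stopped t) = UNIV"
  by (simp_all add: stopped_def)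

lemma finite_measure_stopped: "finite_measure (stopped t)"
  by standard (use emeasure_varm_finite[of "{0<..t}" 0 t] in \<open>simp add: stopped_def emeasure_density less_top\<close>)

text \<open>The occupation measure spreads the mass of an upward jump uniformly over the interval jumped.\<close>

definition occupation :: "real \<Rightarrow> real measure" where
  "occupation t = distr (stopped t \<Otimes>\<^sub>M unit_uniform) borel (case_prod jump_segment)"

text \<open>The fraction of the mass at time \<open>s\<close> that \<open>occupation\<close> places
  in \<open>A\<close>.\<close>

definition spread :: "real set \<Rightarrow> real \<Rightarrow> ennreal" where
  "spread A s = (\<integral>\<^sup>+\<theta>. indicator A (jump_segment s \<theta>) \<partial>unit_uniform)"

lemma measurable_spread [measurable]:
  assumes [measurable]: "A \<in> sets borel"
  shows "spread A \<in> borel_measurable borel"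
proof -
  interpret finite_measure unit_uniform by (rule finite_measure_unit_uniform)
  show ?thesis unfolding spread_def[abs_def] by measurable
qed

lemma emeasure_occupation:
  assumes [measurable]: "A \<in> sets borel"
  shows "emeasure (occupation t) A = emeasure (density varm (spread A)) {0<..t}"
proof -
  interpret U: finite_measure unit_uniform by (rule finite_measure_unit_uniform)
  let ?f = "case_prod jump_segment"
  have [measurable]: "?f \<in> borel_measurable (stopped t \<Otimes>\<^sub>M unit_uniform)"
    by measurable
  have "emeasure (occupation t) A = emeasure (stopped t \<Otimes>\<^sub>M unit_uniform) (?f -` A \<inter> space (stopped t \<Otimes>\<^sub>M unit_uniform))"
    unfolding occupation_def by (rule emeasure_distr) measurable
  also have "\<dots> = (\<integral>\<^sup>+s. \<integral>\<^sup>+\<theta>. indicator (?f -` A \<inter> space (stopped t \<Otimes>\<^sub>M unit_uniform)) (s, \<theta>) \<partial>unit_uniform \<partial>stopped t)"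
    by (rule U.emeasure_pair_measure) measurable
  also have "\<dots> = (\<integral>\<^sup>+s. spread A s \<partial>stopped t)"
    unfolding spread_def by (simp add: space_pair_measure indicator_def)
  also have "\<dots> = emeasure (density varm (spread A)) {0<..t}"
    unfolding stopped_def by (subst nn_integral_density) (auto simp: emeasure_density mult.commute)
  finally show ?thesis .
qed

lemma spread_nonjump: "s \<notin> jumps \<Longrightarrow> spread A s = indicator A (path_ext s)"
  unfolding spread_def jump_segment_def path_ext_diff
  by (simp add: left_ext_def emeasure_unit_uniform)

lemma spread_jump:
  assumes "s > 0" "jump x s > 0" and [measurable]: "A \<in> sets borel"
  shows "spread A s * ennreal (jump x s) = emeasure lborel (A \<inter> {left_lim x s<..<x s})"
proof -
  have "s \<in> jumps" using assms by (simp add: jumps_def)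
  have "spread A s = (\<integral>\<^sup>+\<theta>\<in>{0<..<1}. indicator A (left_lim x s + \<theta> * (x s - left_lim x s)) \<partial>lborel)"
    unfolding spread_def unit_uniform_def jump_segment_def using assms(1)
    by (subst nn_integral_density) (auto simp: left_ext_eq path_ext_eq mult.commute)
  then have "spread A s * ennreal (jump x s) = (\<integral>\<^sup>+z\<in>{left_lim x s<..<x s}. indicator A z \<partial>lborel)"
    using nn_integral_segment[of "left_lim x s" "x s" "indicator A"] assms(2) by (simp add: jump_def)
  also have "\<dots> = emeasure lborel (A \<inter> {left_lim x s<..<x s})"
    by (simp add: indicator_inter_arith[symmetric])
  finally show ?thesis .
qed

lemma emeasure_occupation_UNIV:
  assumes "t \<ge> 0"
  shows "emeasure (occupation t) UNIV = UTV x 0 t"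
proof -
  have "spread UNIV s = 1" for s by (simp add: spread_def emeasure_unit_uniform)
  then show ?thesis
    using assms by (simp add: emeasure_occupation emeasure_density emeasure_varm_Ioc_UTV)
qed

section \<open>Occupation dominates crossing counts, and equality\<close>

lemma continuous_off_jumps:
  assumes "s > 0" "s \<notin> jumps"
  shows "isCont x s"
  using assms tendsto_left_lim[of s] right_cont[of s]
  by (simp add: isCont_def filterlim_at_split jumps_def jump_def)

text \<open>The comparison is made on three pieces of \<open>{0<..t}\<close>: at jump times the two
  measures agree; at other times with the path in \<open>A\<close> the variation of
  \<open>G \<circ> x\<close> is at most that of \<open>x\<close>; at the remaining times
  \<open>G \<circ> x\<close> has none.\<close>

lemma UTV_comp_le_occupation:
  assumes "t > 0" and A: "closed A"
    and G: "mono G" "\<And>u v. \<bar>G u - G v\<bar> \<le> \<bar>u - v\<bar>"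
    and leb: "\<And>u v. u \<le> v \<Longrightarrow> emeasure lborel (A \<inter> {u<..<v}) = ennreal (G v - G u)"
    and Gx: "fv_path (\<lambda>s. G (x s))"
  shows "UTV (\<lambda>s. G (x s)) 0 t \<le> emeasure (occupation t) A"
proof -
  interpret G: fv_path "\<lambda>s. G (x s)" by (rule Gx)
  have [measurable]: "A \<in> sets borel" using A by (rule borel_closed)
  have contG: "isCont G u" for u
    unfolding isCont_def
  proof (rule metric_LIM_I)
    fix e :: real assume "e > 0"
    then show "\<exists>s>0. \<forall>v. v \<noteq> u \<and> dist v u < s \<longrightarrow> dist (G v) (G u) < e"
      using G(2) by (intro exI[of _ e]) (auto simp: dist_real_def intro: le_less_trans)
  qed
  have inc: "max 0 (G (x v) - G (x u)) \<le> max 0 (x v - x u)" for u v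
    using G(2)[of "x v" "x u"] monoD[OF G(1), of "x v" "x u"] by (auto simp: max_def)
  let ?L = "G.varm"
  let ?K = "density varm (spread A)"
  define C where "C = {0<..t} \<inter> jumps"
  define B1 where "B1 = {s\<in>{0<..t} - jumps. path_ext s \<in> A}"
  define B2 where "B2 = {s\<in>{0<..t} - jumps. path_ext s \<notin> A}"
  have "{s \<in> space borel. path_ext s \<in> A} \<in> sets borel"
    by measurable
  then have pathA: "{s. path_ext s \<in> A} \<in> sets borel" by simp
  have "B1 = ({0<..t} - jumps) \<inter> {s. path_ext s \<in> A}" "B2 = ({0<..t} - jumps) - {s. path_ext s \<in> A}"
    by (auto simp: B1_def B2_def)
  with pathA have [measurable]: "C \<in> sets borel" "B1 \<in> sets borel" "B2 \<in> sets borel"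
    by (auto simp: C_def)
  have countC: "countable C" using countable_jumps by (simp add: C_def countable_Int2)
  \<comment> \<open>For an upward jump both atoms equal the Lebesgue measure of \<open>A\<close>
    inside the jumped interval; for a downward jump both vanish.\<close>
  have L_C: "emeasure ?L C = emeasure ?K C"
  proof -
    have "emeasure ?L {s} = emeasure ?K {s}" if "s \<in> C" for s
    proof -
      have s: "s > 0" using that by (simp add: C_def)
      have "((\<lambda>u. G (x u)) \<longlongrightarrow> G (left_lim x s)) (at_left s)"
        by (rule isCont_tendsto_compose[OF contG tendsto_left_lim[OF s]])
      then have "left_lim (\<lambda>u. G (x u)) s = G (left_lim x s)"
        unfolding left_lim_def[of "\<lambda>u. G (x u)"] by (intro tendsto_Lim) auto
      then have L: "emeasure ?L {s} = ennreal (max 0 (G (x s) - G (left_lim x s)))"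
        using s by (simp add: G.emeasure_varm_singleton jump_def)
      have K: "emeasure ?K {s} = spread A s * ennreal (max 0 (jump x s))"
        using s by (simp add: emeasure_density nn_integral_indicator_singleton emeasure_varm_singleton)
      show ?thesis
      proof (cases "jump x s > 0")
        case True
        then have "emeasure ?K {s} = emeasure lborel (A \<inter> {left_lim x s<..<x s})"
          using s by (simp add: K max_def spread_jump)
        also have "\<dots> = ennreal (G (x s) - G (left_lim x s))"
          using True by (intro leb) (simp add: jump_def)
        finally show ?thesis
          using monoD[OF G(1), of "left_lim x s" "x s"] True by (simp add: L jump_def max_def)
      next
        case False
        then show ?thesis
          using monoD[OF G(1), of "x s" "left_lim x s"] by (simp add: L K jump_def max_def)
      qed
    qed
    then show ?thesis
      using countC by (simp add: emeasure_countable_singleton[of C] cong: nn_integral_cong_simp)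
  qed
  have L_B1: "emeasure ?L B1 \<le> emeasure ?K B1"
  proof -
    have "UTV (\<lambda>s. G (x s)) a b \<le> UTV x a b" if "0 \<le> a" "a \<le> b" for a b
      unfolding UTV_eq_cumvar[OF that]
      by (intro UTV_leI[OF that(2)] order_trans[OF inc cumvar_increment]) (use that in auto)
    then have "emeasure ?L B1 \<le> emeasure varm B1"
      by (intro G.emeasure_varm_mono) (auto intro: fv_path_axioms)
    also have "emeasure varm B1 = emeasure ?K B1"
      by (simp add: emeasure_density)
        (auto intro!: nn_integral_cong simp: B1_def spread_nonjump indicator_def simp flip: nn_integral_indicator)
    finally show ?thesis .
  qed
  have L_B2: "emeasure ?L B2 = 0"
  proof -
    \<comment> \<open>The remaining times are covered by open sets that are null for
      \<open>?L\<close>. The cover may be uncountable, so Lindelof's theorem extracts a countable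
      one.\<close>
    define \<F> where "\<F> = {V. open V \<and> emeasure ?L V = 0}"
    have "B2 \<subseteq> \<Union>\<F>"
    proof
      fix s assume "s \<in> B2"
      then have s: "s > 0" "s \<notin> jumps" "x s \<notin> A" by (auto simp: B2_def path_ext_eq)
      then obtain \<epsilon> where \<epsilon>: "\<epsilon> > 0" "ball (x s) \<epsilon> \<inter> A = {}"
        using A by (metis ComplI closed_def disjoint_eq_subset_Compl open_contains_ball)
      \<comment> \<open>The ball misses \<open>A\<close>, so the primitive \<open>G\<close> of its
        indicator has no increment between two points of the ball.\<close>
      have Gconst: "G v = G (x s)" if "v \<in> ball (x s) \<epsilon>" for v
      proof -
        have "A \<inter> {u<..<w} = {}" if "u \<in> ball (x s) \<epsilon>" "w \<in> ball (x s) \<epsilon>" for u w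
        proof -
          have "{u<..<w} \<subseteq> ball (x s) \<epsilon>" using that by (auto simp: dist_real_def)
          then show ?thesis using \<epsilon>(2) by blast
        qed
        then have "G w \<le> G u" if "u \<le> w" "u \<in> ball (x s) \<epsilon>" "w \<in> ball (x s) \<epsilon>" for u w
          using leb[OF that(1)] that by (metis diff_gt_0_iff_gt emeasure_empty ennreal_eq_0_iff leD leI)
        from this[of v "x s"] this[of "x s" v] show ?thesis
          using that \<epsilon>(1) monoD[OF G(1), of v "x s"] monoD[OF G(1), of "x s" v] by (cases "v \<le> x s") auto
      qed
      obtain \<delta> where \<delta>: "\<delta> > 0" "\<And>u. \<bar>u - s\<bar> < \<delta> \<Longrightarrow> x u \<in> ball (x s) \<epsilon>"
        using continuous_off_jumps[OF s(1,2)] \<epsilon>(1) unfolding isCont_def LIM_def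
        by (auto simp: dist_real_def abs_minus_commute) (metis abs_zero diff_self)
      define r where "r = min (s / 2) (\<delta> / 2)"
      have r: "r > 0" "r < \<delta>" "s - r > 0" using s(1) \<delta>(1) by (auto simp: r_def min_def)
      have "UTV (\<lambda>s. G (x s)) (s - r) (s + r) \<le> ennreal (0 - 0)"
      proof (rule UTV_leI[where F="\<lambda>_. 0"])
        fix u v assume "s - r \<le> u" "u \<le> v" "v \<le> s + r"
        then have "x u \<in> ball (x s) \<epsilon>" "x v \<in> ball (x s) \<epsilon>" using r \<delta>(2)[of u] \<delta>(2)[of v] by auto
        then show "max 0 (G (x v) - G (x u)) \<le> 0 - 0" by (simp add: Gconst)
      qed (use r in simp)
      then have "emeasure ?L {s - r<..s + r} = 0" using r by (simp add: G.emeasure_varm_Ioc_UTV)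
      moreover have "emeasure ?L {s - r<..<s + r} \<le> emeasure ?L {s - r<..s + r}"
        by (rule emeasure_mono) auto
      ultimately have "{s - r<..<s + r} \<in> \<F>" by (simp add: \<F>_def)
      moreover have "s \<in> {s - r<..<s + r}" using r by simp
      ultimately show "s \<in> \<Union>\<F>" by blast
    qed
    moreover obtain \<F>' where \<F>': "\<F>' \<subseteq> \<F>" "countable \<F>'" "\<Union>\<F>' = \<Union>\<F>"
      using Lindelof[of \<F>] by (auto simp: \<F>_def)
    moreover have "(\<Union>V\<in>\<F>'. V) \<in> null_sets ?L"
      using \<F>'(1) by (intro null_sets_UN' \<F>'(2)) (auto simp: \<F>_def null_sets_def)
    ultimately have "B2 \<in> null_sets ?L"
      by (intro null_sets_subset[of "\<Union>\<F>'" ?L B2]) auto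
    then show ?thesis by auto
  qed
  have split: "{0<..t} = C \<union> B1 \<union> B2" and disj: "C \<inter> B1 = {}"
    by (auto simp: C_def B1_def B2_def)
  have "UTV (\<lambda>s. G (x s)) 0 t = emeasure ?L (C \<union> B1 \<union> B2)"
    using assms(1) by (simp add: G.emeasure_varm_Ioc_UTV flip: split)
  also have "\<dots> \<le> emeasure ?L (C \<union> B1) + emeasure ?L B2"
    by (rule emeasure_subadditive) auto
  also have "\<dots> \<le> emeasure ?L C + emeasure ?L B1"
    using L_B2 by (auto intro!: emeasure_subadditive)
  also have "\<dots> \<le> emeasure ?K C + emeasure ?K B1"
    using L_C L_B1 by (simp add: add_left_mono)
  also have "\<dots> = emeasure ?K (C \<union> B1)"
    using disj by (intro plus_emeasure) auto
  also have "\<dots> \<le> emeasure ?K {0<..t}"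
    by (rule emeasure_mono) (auto simp: split)
  finally show ?thesis by (simp add: emeasure_occupation)
qed

lemma fv_path_comp:
  assumes "continuous_on UNIV G" "\<And>u v. \<bar>G u - G v\<bar> \<le> \<bar>u - v\<bar>"
  shows "fv_path (\<lambda>s. G (x s))"
  by unfold_locales (rule cadlag_fv_comp[OF x_fv assms])

theorem density_level_up_count:
  assumes "t > 0"
  shows "density lborel (level_up_count x t) = occupation t"
proof -
  let ?m = "density lborel (level_up_count x t)"
  note [measurable] = measurable_level_up_count[OF assms]
  have sets: "sets (occupation t) = sets borel" "sets ?m = sets borel"
    by (simp_all add: occupation_def)
  have le: "emeasure ?m A \<le> emeasure (occupation t) A"
    if "closed A" "mono G" "continuous_on UNIV G" "\<And>u v. \<bar>G u - G v\<bar> \<le> \<bar>u - v\<bar>"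
      "\<And>u v. u \<le> v \<Longrightarrow> emeasure lborel (A \<inter> {u<..<v}) = ennreal (G v - G u)" for A G
  proof -
    have "emeasure ?m A = (\<integral>\<^sup>+z\<in>A. level_up_count x t z \<partial>lborel)"
      using that(1) by (simp add: emeasure_density borel_closed)
    also have "\<dots> \<le> UTV (\<lambda>s. G (x s)) 0 t"
      using that by (intro nn_integral_level_up_count_le assms fv_path_comp) (auto simp: borel_closed)
    also have "\<dots> \<le> emeasure (occupation t) A"
      using that by (intro UTV_comp_le_occupation assms fv_path_comp) auto
    finally show ?thesis .
  qed
  \<comment> \<open>\<open>min a\<close> is a primitive of the indicator of \<open>{..a}\<close>;
    whether the endpoint \<open>a\<close> is included does not affect Lebesgue measure.\<close>
  have upper: "emeasure ?m {..a} \<le> emeasure (occupation t) {..a}" for a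
  proof (rule le[where G="min a"])
    fix u v :: real assume "u \<le> v"
    have "emeasure lborel ({..a} \<inter> {u<..<v}) = emeasure lborel {u<..<min a v}"
      by (rule emeasure_eq_AE) (use AE_lborel_singleton[of a] in \<open>auto elim!: eventually_mono\<close>)
    then show "emeasure lborel ({..a} \<inter> {u<..<v}) = ennreal (min a v - min a u)"
      using \<open>u \<le> v\<close> by (auto simp: min_def)
  qed (auto simp: mono_def intro!: continuous_intros)
  have lower: "emeasure ?m {a..} \<le> emeasure (occupation t) {a..}" for a
  proof (rule le[where G="max a"])
    fix u v :: real assume "u \<le> v"
    have "emeasure lborel ({a..} \<inter> {u<..<v}) = emeasure lborel {max a u<..<v}"
      by (rule emeasure_eq_AE) (use AE_lborel_singleton[of a] in \<open>auto elim!: eventually_mono\<close>)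
    then show "emeasure lborel ({a..} \<inter> {u<..<v}) = ennreal (max a v - max a u)"
      using \<open>u \<le> v\<close> by (auto simp: max_def)
  qed (auto simp: mono_def intro!: continuous_intros)
  \<comment> \<open>Closed half-lines exhaust the open one from inside, so the bound survives in the
    limit.\<close>
  have lower': "emeasure ?m {a<..} \<le> emeasure (occupation t) {a<..}" for a
  proof -
    have eq: "{a<..} = (\<Union>n. {a + 1 / real (Suc n)..})"
    proof safe
      fix b assume "a < b"
      then obtain n where "1 / real (Suc n) < b - a" using nat_approx_posE[of "b - a"] by auto
      then show "b \<in> (\<Union>n. {a + 1 / real (Suc n)..})" by (intro UN_I[of n]) auto
    next
      fix b and n :: nat assume "a + 1 / real (Suc n) \<le> b"
      moreover have "1 / real (Suc n) > 0" by simp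
      ultimately show "a < b" by linarith
    qed
    have inc: "incseq (\<lambda>n. {a + 1 / real (Suc n)..})"
      by (intro incseq_SucI) (auto simp: frac_le intro: order_trans[rotated])
    have "(SUP n. emeasure ?m {a + 1 / real (Suc n)..}) = emeasure ?m (\<Union>n. {a + 1 / real (Suc n)..})"
      by (rule SUP_emeasure_incseq[OF _ inc]) auto
    then have "emeasure ?m {a<..} = (SUP n. emeasure ?m {a + 1 / real (Suc n)..})"
      by (simp only: eq)
    also have "\<dots> \<le> emeasure (occupation t) {a<..}"
    proof (rule SUP_least)
      fix n
      have "{a + 1 / real (Suc n)..} \<subseteq> {a<..}"
        unfolding eq by blast
      then show "emeasure ?m {a + 1 / real (Suc n)..} \<le> emeasure (occupation t) {a<..}"
        by (intro order_trans[OF lower] emeasure_mono) (auto simp: sets)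
    qed
    finally show ?thesis .
  qed
  have total: "emeasure ?m UNIV = emeasure (occupation t) UNIV"
  proof (rule antisym)
    show "emeasure ?m UNIV \<le> emeasure (occupation t) UNIV"
      by (rule le[where G="\<lambda>u. u"]) (auto simp: mono_def)
    show "emeasure (occupation t) UNIV \<le> emeasure ?m UNIV"
      using UTV_le_nn_integral_level_up_count[OF assms] assms by (simp add: emeasure_occupation_UNIV emeasure_density)
  qed
  have fin: "emeasure (occupation t) A < \<infinity>" for A
  proof -
    have "emeasure (occupation t) A \<le> emeasure (occupation t) UNIV"
      using emeasure_space[of "occupation t" A] by (simp add: occupation_def)
    also have "\<dots> < \<infinity>" using assms UTV_finite[of 0 t] by (simp add: emeasure_occupation_UNIV)
    finally show ?thesis .
  qed
  show ?thesis
  proof (rule measure_eqI_lessThan)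
    fix a :: real
    show "emeasure ?m {a<..} < \<infinity>" using lower'[of a] fin by (rule le_less_trans)
    have UNIV: "{..a} \<union> {a<..} = UNIV" by auto
    \<comment> \<open>Equal finite totals turn the upper bound on \<open>{..a}\<close> into a lower
      bound on \<open>{a<..}\<close>.\<close>
    have "emeasure (occupation t) {..a} + emeasure (occupation t) {a<..} = emeasure ?m {..a} + emeasure ?m {a<..}"
      using total by (subst (1 2) plus_emeasure) (auto simp: sets UNIV)
    also have "\<dots> \<le> emeasure (occupation t) {..a} + emeasure ?m {a<..}"
      by (rule add_right_mono[OF upper])
    finally have "emeasure (occupation t) {a<..} \<le> emeasure ?m {a<..}"
      using fin[of "{..a}"] by (auto simp: ennreal_add_left_cancel_le)
    with lower'[of a] show "emeasure ?m {a<..} = emeasure (occupation t) {a<..}" by (rule antisym)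
  qed (simp_all add: sets)
qed

end

section \<open>The level-crossing formula\<close>

lemma locally_bounded_on_compact:
  assumes "locally_bounded g" "compact S"
  obtains B where "\<And>z. z \<in> S \<Longrightarrow> \<bar>g z\<bar> \<le> B"
proof -
  obtain U where U: "\<And>z. open (U z)" "\<And>z. z \<in> U z" "\<And>z. bounded (g ` U z)"
    using assms(1) unfolding locally_bounded_def by metis
  show thesis
  proof (rule compactE_image[OF assms(2), of UNIV U])
    show "S \<subseteq> (\<Union>z\<in>UNIV. U z)" using U(2) by blast
    fix T assume T: "finite T" "S \<subseteq> (\<Union>z\<in>T. U z)"
    have "bounded (\<Union>z\<in>T. g ` U z)" using T(1) U(3) by (intro bounded_UN) auto
    then obtain B where B: "\<forall>y\<in>(\<Union>z\<in>T. g ` U z). norm y \<le> B" unfolding bounded_iff by blast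
    show thesis
    proof (rule that[of B])
      fix z assume "z \<in> S"
      then have "g z \<in> (\<Union>z\<in>T. g ` U z)" using T(2) by blast
      then show "\<bar>g z\<bar> \<le> B" using B by (metis real_norm_def)
    qed
  qed (use U(1) in auto)
qed

text \<open>\<open>real_of_enat\<close> and \<open>enn2real\<close> both send infinity to 0.\<close>

lemma real_of_enat_level_up: "real_of_enat (level_up z x 0 t) = enn2real (level_up_count x t z)"
  by (cases "level_up z x 0 t") (simp_all add: real_of_enat_def level_up_count_def)

context fv_path
begin

interpretation uminus: fv_path "\<lambda>s. - x s"
  by (rule fv_path_uminus)

text \<open>By the Jordan decomposition the path stays within this bound on \<open>{0..t}\<close>,
  and no level beyond it is crossed; this permits cutting off \<open>g\<close>.\<close>

definition bound :: "real \<Rightarrow> real" where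
  "bound t = \<bar>x 0\<bar> + cumvar t + fv_path.cumvar (\<lambda>s. - x s) t"

lemma abs_le_bound:
  assumes "0 \<le> s" "s \<le> t"
  shows "\<bar>x s\<bar> \<le> bound t"
  using jordan[OF assms(1)] cumvar_mono[OF assms(2)] uminus.cumvar_mono[OF assms(2)]
    cumvar_nonneg[of s] uminus.cumvar_nonneg[of s]
  by (simp add: bound_def)

lemma abs_left_lim_le_bound:
  assumes "0 < s" "s \<le> t"
  shows "\<bar>left_lim x s\<bar> \<le> bound t"
proof (rule tendsto_upperbound[OF tendsto_rabs[OF tendsto_left_lim[OF assms(1)]]])
  show "eventually (\<lambda>u. \<bar>x u\<bar> \<le> bound t) (at_left s)"
    unfolding eventually_at_left_field using assms by (intro exI[of _ 0]) (auto intro!: abs_le_bound)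
qed simp

lemma level_up_count_eq_0:
  assumes "t \<ge> 0" "bound t < \<bar>z\<bar>"
  shows "level_up_count x t z = 0"
proof -
  have "n = 0" if "up_chain x z 0 n t" for n
  proof (cases n)
    case (Suc m)
    then obtain a b where ab: "up_chain x z 0 m a" "a \<le> b" "b \<le> t" "x a < z" "z < x b"
      using \<open>up_chain x z 0 n t\<close> by auto
    then have "0 \<le> a" by (auto dest: up_chain_nonneg)
    with ab have "\<bar>x a\<bar> \<le> bound t" "\<bar>x b\<bar> \<le> bound t" by (auto intro!: abs_le_bound)
    with ab assms(2) show ?thesis by linarith
  qed simp
  then have "enat ` {n. up_chain x z 0 n t} \<subseteq> {0}" by (auto simp: zero_enat_def)
  then have "Sup (enat ` {n. up_chain x z 0 n t}) \<le> Sup {0}" by (rule Sup_subset_mono)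
  then show ?thesis using assms(1) by (simp add: level_up_count_def level_up_eq_Sup)
qed

lemma nn_integral_level_up_count:
  assumes "t > 0"
  shows "(\<integral>\<^sup>+z. level_up_count x t z \<partial>lborel) = UTV x 0 t"
  using emeasure_occupation_UNIV[of t] assms measurable_level_up_count[OF assms]
  by (simp add: density_level_up_count[symmetric] emeasure_density)

lemma AE_level_up_finite:
  assumes "t > 0"
  shows "AE z in lborel. level_up z x 0 t < \<infinity>"
proof -
  have "AE z in lborel. level_up_count x t z \<noteq> \<infinity>"
    using assms UTV_finite[of 0 t] measurable_level_up_count[OF assms]
    by (intro nn_integral_PInf_AE) (auto simp: nn_integral_level_up_count)
  then show ?thesis
    by eventually_elim (auto simp: level_up_count_def ennreal_of_enat_def split: enat.splits)
qed

lemma occupation_eq_density: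
  assumes "t > 0"
  shows "occupation t = density lborel (\<lambda>z. ennreal (enn2real (level_up_count x t z)))"
  unfolding density_level_up_count[OF assms, symmetric]
proof (rule density_cong)
  note [measurable] = measurable_level_up_count[OF assms]
  show "level_up_count x t \<in> borel_measurable lborel" by measurable
  show "(\<lambda>z. ennreal (enn2real (level_up_count x t z))) \<in> borel_measurable lborel" by measurable
  show "AE z in lborel. level_up_count x t z = ennreal (enn2real (level_up_count x t z))"
    using AE_level_up_finite[OF assms]
    by eventually_elim (auto simp: level_up_count_def ennreal_of_nat_eq_real_of_nat)
qed

section \<open>Integration against the occupation measure\<close>

lemma finite_measure_occupation: "finite_measure (occupation t)"
proof -
  interpret finite_measure "stopped t" by (rule finite_measure_stopped)
  interpret U: finite_measure unit_uniform by (rule finite_measure_unit_uniform)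
  have "emeasure (stopped t \<Otimes>\<^sub>M unit_uniform) UNIV = emeasure (stopped t) UNIV * emeasure unit_uniform UNIV"
    using U.emeasure_pair_measure_Times[of UNIV "stopped t" UNIV] by simp
  also have "\<dots> \<noteq> \<infinity>" using emeasure_finite[of UNIV] by (simp add: emeasure_unit_uniform)
  finally have "finite_measure (stopped t \<Otimes>\<^sub>M unit_uniform)"
    by (intro finite_measureI) (simp add: space_pair_measure)
  then show ?thesis
    unfolding occupation_def by (rule finite_measure.finite_measure_distr) measurable
qed

text \<open>Counterpart of \<open>spread\<close> for real integrands: at a jump the average of
  \<open>f\<close> over the jumped segment, elsewhere just the value of \<open>f\<close> on the
  path.\<close>

definition jump_mean :: "(real \<Rightarrow> real) \<Rightarrow> real \<Rightarrow> real" where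
  "jump_mean f s = (\<integral>\<theta>. f (jump_segment s \<theta>) \<partial>unit_uniform)"

text \<open>Fubini on the product that defines \<open>occupation\<close>; boundedness of
  \<open>f\<close> and finiteness of the measures supply integrability.\<close>

lemma integral_occupation:
  assumes f [measurable]: "f \<in> borel_measurable borel" and B: "\<And>z. \<bar>f z\<bar> \<le> B"
  shows "integrable (occupation t) f" "jump_mean f \<in> borel_measurable borel" "\<bar>jump_mean f s\<bar> \<le> B"
    "integral\<^sup>L (occupation t) f = (LINT s:{0<..t}|varm. jump_mean f s)"
proof -
  interpret O: finite_measure "occupation t" by (rule finite_measure_occupation)
  interpret S: finite_measure "stopped t" by (rule finite_measure_stopped)
  interpret U: finite_measure unit_uniform by (rule finite_measure_unit_uniform)
  interpret P: pair_sigma_finite "stopped t" unit_uniform ..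
  have sets_O [measurable_cong]: "sets (occupation t) = sets borel" by (simp add: occupation_def)
  show int: "integrable (occupation t) f"
    using B by (intro O.integrable_const_bound[where B=B]) auto
  show meas [measurable]: "jump_mean f \<in> borel_measurable borel"
    unfolding jump_mean_def[abs_def] by measurable
  have "\<bar>jump_mean f s\<bar> \<le> (\<integral>\<theta>. B \<partial>unit_uniform)"
    unfolding jump_mean_def
    using B order_trans[OF abs_ge_zero B] by (intro order_trans[OF integral_abs_bound] integral_mono U.integrable_const_bound[where B=B]) auto
  then show "\<bar>jump_mean f s\<bar> \<le> B" by (simp add: measure_def emeasure_unit_uniform)
  have int': "integrable (stopped t \<Otimes>\<^sub>M unit_uniform) (\<lambda>y. f (case_prod jump_segment y))"
    using int unfolding occupation_def by (subst (asm) integrable_distr_eq) auto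
  have "integral\<^sup>L (occupation t) f = (\<integral>y. f (case_prod jump_segment y) \<partial>(stopped t \<Otimes>\<^sub>M unit_uniform))"
    unfolding occupation_def by (rule integral_distr) measurable
  also have "\<dots> = (\<integral>s. jump_mean f s \<partial>stopped t)"
    unfolding jump_mean_def using P.integral_fst'[OF int'] by simp
  also have "stopped t = density varm (\<lambda>s. ennreal (indicator {0<..t} s))"
    by (simp add: stopped_def ennreal_indicator)
  also have "integral\<^sup>L \<dots> (jump_mean f) = (LINT s:{0<..t}|varm. jump_mean f s)"
    unfolding set_lebesgue_integral_def by (rule integral_density) auto
  finally show "integral\<^sup>L (occupation t) f = (LINT s:{0<..t}|varm. jump_mean f s)" .
qed

lemma jump_mean_nonjump: "s \<notin> jumps \<Longrightarrow> jump_mean f s = f (path_ext s)"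
  unfolding jump_mean_def jump_segment_def path_ext_diff
  by (simp add: left_ext_def measure_def emeasure_unit_uniform)

lemma jump_mean_jump:
  assumes "s > 0" "jump x s > 0" and [measurable]: "f \<in> borel_measurable borel"
  shows "jump x s * jump_mean f s = (LBINT z=left_lim x s..x s. f z)"
proof -
  let ?l = "left_lim x s" and ?r = "x s"
  have lr: "?l < ?r" using assms(2) by (simp add: jump_def)
  have "(LBINT z=?l..?r. f z) = (\<integral>z. indicator {?l<..<?r} z *\<^sub>R f z \<partial>lborel)"
    using lr by (simp add: interval_lebesgue_integral_def set_lebesgue_integral_def)
  also have "\<dots> = (?r - ?l) * (\<integral>\<theta>. indicator {?l<..<?r} (?l + (?r - ?l) * \<theta>) *\<^sub>R f (?l + (?r - ?l) * \<theta>) \<partial>lborel)"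
    using lr by (subst lborel_integral_real_affine[where c="?r - ?l" and t="?l"]) auto
  also have "(\<lambda>\<theta>. indicator {?l<..<?r} (?l + (?r - ?l) * \<theta>) *\<^sub>R f (?l + (?r - ?l) * \<theta>))
      = (\<lambda>\<theta>. indicator {0<..<1} \<theta> *\<^sub>R f (?l + \<theta> * (?r - ?l)))"
    unfolding indicator_def affine_mem_segment_iff[OF lr] by (simp add: mult.commute)
  also have "(\<integral>\<theta>. indicator {0<..<1} \<theta> *\<^sub>R f (?l + \<theta> * (?r - ?l)) \<partial>lborel)
      = (\<integral>\<theta>. f (?l + \<theta> * (?r - ?l)) \<partial>density lborel (\<lambda>\<theta>. ennreal (indicator {0<..<1} \<theta>)))"
    by (subst integral_density) auto
  also have "\<dots> = jump_mean f s"
    using assms(1) by (simp add: jump_mean_def jump_segment_def unit_uniform_def ennreal_indicator left_ext_eq path_ext_eq)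
  finally show ?thesis by (simp add: jump_def)
qed

lemma set_integrable_varm:
  fixes B :: real
  assumes [measurable]: "A \<in> sets borel" "f \<in> borel_measurable borel"
    and "A \<subseteq> {0<..t}" "\<And>s. s \<in> A \<Longrightarrow> \<bar>f s\<bar> \<le> B"
  shows "set_integrable varm A f"
  unfolding set_integrable_def
  using assms emeasure_varm_finite[of A 0 t]
  by (intro integrableI_bounded_set_indicator[where B=B]) (auto intro!: AE_I2)

text \<open>The formulas contain \<open>left_lim x\<close>, which is meaningful only at positive
  times; \<open>f'\<close> stands for an extension to the whole line, where \<open>varm\<close>
  lives.\<close>

lemma pos_var_integral:
  fixes f f' :: "real \<Rightarrow> real"
  assumes "\<And>s. 0 < s \<Longrightarrow> s \<le> t \<Longrightarrow> f s = f' s"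
  shows "set_integrable (pos_var x) {0<..t} f \<longleftrightarrow> set_integrable varm {0<..t} f'"
    "(LINT s:{0<..t}|pos_var x. f s) = (LINT s:{0<..t}|varm. f' s)"
proof -
  have restrict: "integrable (restrict_space varm {0..}) F \<longleftrightarrow> integrable varm (\<lambda>s. indicator {0..} s *\<^sub>R F s)"
    "integral\<^sup>L (restrict_space varm {0..}) F = integral\<^sup>L varm (\<lambda>s. indicator {0..} s *\<^sub>R F s)" for F :: "real \<Rightarrow> real"
    by (rule integrable_restrict_space integral_restrict_space; simp)+
  have eq: "(\<lambda>s. indicator {0..} s *\<^sub>R indicator {0<..t} s *\<^sub>R f s) = (\<lambda>s. indicator {0<..t} s *\<^sub>R f' s)"
    using assms by (auto simp: indicator_def fun_eq_iff)
  show "set_integrable (pos_var x) {0<..t} f \<longleftrightarrow> set_integrable varm {0<..t} f'"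
    unfolding set_integrable_def pos_var_eq restrict eq ..
  show "(LINT s:{0<..t}|pos_var x. f s) = (LINT s:{0<..t}|varm. f' s)"
    unfolding set_lebesgue_integral_def pos_var_eq restrict eq ..
qed

text \<open>\<open>f'\<close> provides measurability on the whole line, whereas \<open>f''\<close>
  only has to match \<open>f\<close> off \<open>jumps\<close>, where the continuous part has all its
  mass.\<close>

lemma pos_var_cont_part_integral:
  fixes f f' f'' :: "real \<Rightarrow> real"
  assumes [measurable]: "f' \<in> borel_measurable borel"
    and "\<And>s. 0 < s \<Longrightarrow> s \<le> t \<Longrightarrow> s \<notin> jumps \<Longrightarrow> f s = f'' s" "\<And>s. 0 < s \<Longrightarrow> s \<le> t \<Longrightarrow> f s = f' s"
  shows "set_integrable (pos_var (cont_part x)) {0<..t} f \<longleftrightarrow> set_integrable varm ({0<..t} - jumps) f''"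
    "(LINT s:{0<..t}|pos_var (cont_part x). f s) = (LINT s:{0<..t} - jumps|varm. f'' s)"
proof -
  have restrict: "integrable (restrict_space contm {0..}) F \<longleftrightarrow> integrable contm (\<lambda>s. indicator {0..} s *\<^sub>R F s)"
    "integral\<^sup>L (restrict_space contm {0..}) F = integral\<^sup>L contm (\<lambda>s. indicator {0..} s *\<^sub>R F s)" for F :: "real \<Rightarrow> real"
    by (rule integrable_restrict_space integral_restrict_space; simp)+
  have eq: "(\<lambda>s. indicator {0..} s *\<^sub>R indicator {0<..t} s *\<^sub>R f s) = (\<lambda>s. indicator {0<..t} s *\<^sub>R f' s)"
    using assms by (auto simp: indicator_def fun_eq_iff)
  have eq': "(\<lambda>s. indicator (- jumps) s *\<^sub>R indicator {0<..t} s *\<^sub>R f' s) = (\<lambda>s. indicator ({0<..t} - jumps) s *\<^sub>R f'' s)"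
    using assms(2,3) by (fastforce simp: indicator_def fun_eq_iff)
  have contm: "contm = density varm (\<lambda>s. ennreal (indicator (- jumps) s))"
    by (simp add: contm_def ennreal_indicator)
  show "set_integrable (pos_var (cont_part x)) {0<..t} f \<longleftrightarrow> set_integrable varm ({0<..t} - jumps) f''"
    unfolding set_integrable_def pos_var_cont_part_eq restrict eq
    unfolding contm
    by (subst integrable_density) (simp_all add: eq'[unfolded real_scaleR_def])
  show "(LINT s:{0<..t}|pos_var (cont_part x). f s) = (LINT s:{0<..t} - jumps|varm. f'' s)"
    unfolding set_lebesgue_integral_def pos_var_cont_part_eq restrict eq
    unfolding contm
    by (subst integral_density) (simp_all add: eq'[unfolded real_scaleR_def])
qed

text \<open>Integrating over the jump times is summing over atoms. Downward jumps have mass 0, so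
  the sum runs over upward ones only.\<close>

lemma has_sum_jump_integral:
  fixes B :: real
  assumes [measurable]: "f \<in> borel_measurable borel" and "\<And>s. 0 < s \<Longrightarrow> s \<le> t \<Longrightarrow> \<bar>f s\<bar> \<le> B"
    and h: "\<And>s. 0 < s \<Longrightarrow> s \<le> t \<Longrightarrow> jump x s > 0 \<Longrightarrow> h s = jump x s * f s"
  shows "(h has_sum (LINT s:{0<..t} \<inter> jumps|varm. f s)) {s\<in>{0<..t}. jump x s > 0}"
proof -
  let ?C = "{0<..t} \<inter> jumps"
  have "((\<lambda>s. measure varm {s} * f s) has_sum (LINT s:?C|varm. f s)) ?C"
  proof (rule has_sum_integral_countable)
    show "countable ?C" using countable_jumps by (rule countable_Int2)
    show "set_integrable varm ?C f" using assms by (intro set_integrable_varm[where t=t and B=B]) auto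
  qed (auto simp: emeasure_varm_singleton)
  then show ?thesis
    by (rule has_sum_cong_neutral[THEN iffD1, rotated -1])
      (auto simp: measure_varm_singleton h jumps_def)
qed

theorem up_formula:
  assumes t: "t > 0" and g [measurable]: "g \<in> borel_measurable borel" and lb: "locally_bounded g"
  defines "J \<equiv> {s\<in>{0<..t}. jump x s > 0}"
  shows "AE z in lborel. level_up z x 0 t < \<infinity>"
    "integrable lborel (\<lambda>z. real_of_enat (level_up z x 0 t) * g z)"
    "set_integrable (pos_var x) {0<..t} (\<lambda>s. g (left_lim x s))"
    "set_integrable (pos_var (cont_part x)) {0<..t} (\<lambda>s. g (left_lim x s))"
    "set_integrable (pos_var (cont_part x)) {0<..t} (\<lambda>s. g (x s))"
    "\<forall>s\<in>J. interval_lebesgue_integrable lborel (left_lim x s) (x s) g"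
    "(\<lambda>s. LBINT z=left_lim x s..x s. (g z - g (left_lim x s))) summable_on J"
    "(\<lambda>s. LBINT z=left_lim x s..x s. g z) summable_on J"
    "(LINT z|lborel. real_of_enat (level_up z x 0 t) * g z)
      = (LINT s:{0<..t}|pos_var x. g (left_lim x s))
        + (\<Sum>\<^sub>\<infinity>s\<in>J. LBINT z=left_lim x s..x s. (g z - g (left_lim x s)))"
    "(LINT s:{0<..t}|pos_var x. g (left_lim x s))
        + (\<Sum>\<^sub>\<infinity>s\<in>J. LBINT z=left_lim x s..x s. (g z - g (left_lim x s)))
      = (LINT s:{0<..t}|pos_var (cont_part x). g (left_lim x s))
        + (\<Sum>\<^sub>\<infinity>s\<in>J. LBINT z=left_lim x s..x s. g z)"
    "(LINT s:{0<..t}|pos_var (cont_part x). g (left_lim x s))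
        + (\<Sum>\<^sub>\<infinity>s\<in>J. LBINT z=left_lim x s..x s. g z)
      = (LINT s:{0<..t}|pos_var (cont_part x). g (x s))
        + (\<Sum>\<^sub>\<infinity>s\<in>J. LBINT z=left_lim x s..x s. g z)"
proof -
  note [measurable] = measurable_level_up_count[OF t]
  let ?I = "{- bound t..bound t}"
  obtain B where B: "\<And>z. z \<in> ?I \<Longrightarrow> \<bar>g z\<bar> \<le> B"
    using locally_bounded_on_compact[OF lb, of ?I] by auto
  have bound_nonneg: "0 \<le> bound t" using abs_le_bound[of 0 t] t by simp
  have B0: "0 \<le> B" using B[of 0] bound_nonneg by simp
  \<comment> \<open>\<open>g\<close> is bounded only locally. Up to time \<open>t\<close> the path
    and its left limits stay in \<open>?I\<close>, and no level outside \<open>?I\<close> is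
    crossed, so the cut-off \<open>f\<close> may replace \<open>g\<close> throughout.\<close>
  define f where "f z = (if z \<in> ?I then g z else 0)" for z
  have f [measurable]: "f \<in> borel_measurable borel" unfolding f_def[abs_def] by measurable
  have fB: "\<bar>f z\<bar> \<le> B" for z using B[of z] B0 by (simp add: f_def)
  have fx: "g (x s) = f (path_ext s)" and fl: "g (left_lim x s) = f (left_ext s)" if "0 < s" "s \<le> t" for s
    using that abs_le_bound[of s t] abs_left_lim_le_bound[of s t] by (auto simp: f_def path_ext_eq left_ext_eq abs_le_iff)
  have level: "real_of_enat (level_up z x 0 t) * g z = enn2real (level_up_count x t z) * f z" for z
    using level_up_count_eq_0[of t z] t by (auto simp: real_of_enat_level_up f_def abs_le_iff not_le)
  note occ = integral_occupation[OF f fB]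
  note [measurable] = occ(2)
  show "AE z in lborel. level_up z x 0 t < \<infinity>" by (rule AE_level_up_finite[OF t])
  show "integrable lborel (\<lambda>z. real_of_enat (level_up z x 0 t) * g z)"
    unfolding level using occ(1)[of t] unfolding occupation_eq_density[OF t]
    by (subst (asm) integrable_density) auto
  have main: "(LINT z|lborel. real_of_enat (level_up z x 0 t) * g z) = (LINT s:{0<..t}|varm. jump_mean f s)"
    unfolding level occ(4)[symmetric] occupation_eq_density[OF t] by (subst integral_density) auto
  let ?C = "{0<..t} \<inter> jumps" and ?R = "{0<..t} - jumps"
  have setint: "set_integrable varm A h"
    if "A \<in> sets borel" "A \<subseteq> {0<..t}" "h \<in> borel_measurable borel" "\<And>s. \<bar>h s\<bar> \<le> B" for A h
    using that by (intro set_integrable_varm[where t=t and B=B]) auto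
  have split: "(LINT s:{0<..t}|varm. h s) = (LINT s:?R|varm. h s) + (LINT s:?C|varm. h s)"
    if "h \<in> borel_measurable borel" "\<And>s. \<bar>h s\<bar> \<le> B" for h
  proof -
    have eq: "?R \<union> ?C = {0<..t}" and disj: "?R \<inter> ?C = {}" by auto
    have "(LINT s:?R \<union> ?C|varm. h s) = (LINT s:?R|varm. h s) + (LINT s:?C|varm. h s)"
      using that by (intro set_integral_Un disj setint) auto
    then show ?thesis unfolding eq .
  qed
  \<comment> \<open>Off \<open>jumps\<close> the left limit, the value and the average over the
    segment coincide. Hence \<open>x s\<close> and its left limit are interchangeable in integrals
    against the continuous part.\<close>
  have R: "(LINT s:?R|varm. f (left_ext s)) = (LINT s:?R|varm. jump_mean f s)"
    "(LINT s:?R|varm. f (path_ext s)) = (LINT s:?R|varm. jump_mean f s)"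
    by (intro set_lebesgue_integral_cong; simp add: jump_mean_nonjump left_ext_def)+
  have pre: "set_integrable (pos_var x) {0<..t} (\<lambda>s. g (left_lim x s))"
    "(LINT s:{0<..t}|pos_var x. g (left_lim x s)) = (LINT s:{0<..t}|varm. f (left_ext s))"
    using pos_var_integral[of t "\<lambda>s. g (left_lim x s)" "\<lambda>s. f (left_ext s)"] fl setint[of "{0<..t}" "\<lambda>s. f (left_ext s)"] fB
    by auto
  then show "set_integrable (pos_var x) {0<..t} (\<lambda>s. g (left_lim x s))" by simp
  have cpre: "set_integrable (pos_var (cont_part x)) {0<..t} (\<lambda>s. g (left_lim x s))"
    "(LINT s:{0<..t}|pos_var (cont_part x). g (left_lim x s)) = (LINT s:?R|varm. f (left_ext s))"
    using pos_var_cont_part_integral[of "\<lambda>s. f (left_ext s)" t "\<lambda>s. g (left_lim x s)" "\<lambda>s. f (left_ext s)"] fl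
      setint[of ?R "\<lambda>s. f (left_ext s)"] fB
    by auto
  then show "set_integrable (pos_var (cont_part x)) {0<..t} (\<lambda>s. g (left_lim x s))" by simp
  have cpath: "set_integrable (pos_var (cont_part x)) {0<..t} (\<lambda>s. g (x s))"
    "(LINT s:{0<..t}|pos_var (cont_part x). g (x s)) = (LINT s:?R|varm. f (path_ext s))"
    using pos_var_cont_part_integral[of "\<lambda>s. f (path_ext s)" t "\<lambda>s. g (x s)" "\<lambda>s. f (path_ext s)"] fx
      setint[of ?R "\<lambda>s. f (path_ext s)"] fB
    by auto
  then show "set_integrable (pos_var (cont_part x)) {0<..t} (\<lambda>s. g (x s))" by simp
  have gf: "g z = f z" if "s \<in> J" "z \<in> {left_lim x s<..<x s}" for s z
    using that abs_le_bound[of s t] abs_left_lim_le_bound[of s t] by (auto simp: J_def f_def abs_le_iff)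
  have lr: "left_lim x s < x s" if "s \<in> J" for s using that by (simp add: J_def jump_def)
  have int_f: "set_integrable lborel {left_lim x s<..<x s} f" if "s \<in> J" for s
    unfolding set_integrable_def
    using fB lr[OF that] by (intro integrableI_bounded_set_indicator[where B=B]) (auto intro!: AE_I2)
  have int_g: "set_integrable lborel {left_lim x s<..<x s} g" if "s \<in> J" for s
    using int_f[OF that] set_integrable_cong[of lborel lborel "{left_lim x s<..<x s}" "{left_lim x s<..<x s}" g f] gf[OF that] by simp
  show "\<forall>s\<in>J. interval_lebesgue_integrable lborel (left_lim x s) (x s) g"
    using int_g lr by (simp add: interval_lebesgue_integrable_def less_imp_le)
  have LB: "(LBINT z=left_lim x s..x s. g z) = jump x s * jump_mean f s" if "s \<in> J" for s
  proof -
    have "(LBINT z=left_lim x s..x s. g z) = (LBINT z=left_lim x s..x s. f z)"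
      using lr[OF that] gf[OF that]
      by (simp add: interval_lebesgue_integral_def less_imp_le set_lebesgue_integral_cong)
    also have "\<dots> = jump x s * jump_mean f s"
      using that jump_mean_jump[of s f] by (simp add: J_def)
    finally show ?thesis .
  qed
  have LBd: "(LBINT z=left_lim x s..x s. (g z - g (left_lim x s))) = jump x s * (jump_mean f s - f (left_ext s))"
    if "s \<in> J" for s
  proof -
    have "set_integrable lborel {left_lim x s<..<x s} (\<lambda>_. g (left_lim x s))"
      using lr[OF that] by (simp add: set_integrable_def integrable_real_indicator)
    then have "(LBINT z=left_lim x s..x s. (g z - g (left_lim x s)))
      = (LBINT z=left_lim x s..x s. g z) - (LBINT z:{left_lim x s<..<x s}. g (left_lim x s))"
      using int_g[OF that] lr[OF that]
      by (simp add: interval_lebesgue_integral_def less_imp_le set_integral_diff)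
    also have "(LBINT z:{left_lim x s<..<x s}. g (left_lim x s)) = jump x s * g (left_lim x s)"
      using lr[OF that] by (simp add: set_lebesgue_integral_def jump_def)
    finally show ?thesis
      using that fl[of s] by (simp add: LB J_def right_diff_distrib)
  qed
  have sum: "((\<lambda>s. LBINT z=left_lim x s..x s. g z) has_sum (LINT s:?C|varm. jump_mean f s)) J"
    unfolding J_def
    by (rule has_sum_jump_integral[where B=B]) (use occ(3) LB in \<open>auto simp: J_def\<close>)
  have sumd: "((\<lambda>s. LBINT z=left_lim x s..x s. (g z - g (left_lim x s))) has_sum
      (LINT s:?C|varm. jump_mean f s - f (left_ext s))) J"
    unfolding J_def
  proof (rule has_sum_jump_integral[where B="2 * B"])
    fix s show "\<bar>jump_mean f s - f (left_ext s)\<bar> \<le> 2 * B"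
      using occ(3)[of s] fB[of "left_ext s"] by linarith
  qed (use LBd in \<open>auto simp: J_def\<close>)
  show "(\<lambda>s. LBINT z=left_lim x s..x s. (g z - g (left_lim x s))) summable_on J"
    "(\<lambda>s. LBINT z=left_lim x s..x s. g z) summable_on J"
    using sum sumd by (auto simp: summable_on_def)
  have sums: "(\<Sum>\<^sub>\<infinity>s\<in>J. LBINT z=left_lim x s..x s. g z) = (LINT s:?C|varm. jump_mean f s)"
    "(\<Sum>\<^sub>\<infinity>s\<in>J. LBINT z=left_lim x s..x s. (g z - g (left_lim x s)))
      = (LINT s:?C|varm. jump_mean f s) - (LINT s:?C|varm. f (left_ext s))"
    using infsumI[OF sum] infsumI[OF sumd] setint[of ?C "jump_mean f"] setint[of ?C "\<lambda>s. f (left_ext s)"] occ(3) fB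
    by (auto simp: set_integral_diff)
  \<comment> \<open>All sides are now integrals against \<open>varm\<close> over the continuity
    times \<open>?R\<close> and the jump times \<open>?C\<close>. The correction sum exchanges
    \<open>f (left_ext s)\<close> for \<open>jump_mean f s\<close> on \<open>?C\<close>, which turns
    the first expression into the second.\<close>
  note eqs = main pre(2) cpre(2) cpath(2) sums R
  have "\<bar>f (left_ext s)\<bar> \<le> B" "\<bar>f (path_ext s)\<bar> \<le> B" for s by (rule fB)+
  then have splits: "(LINT s:{0<..t}|varm. f (left_ext s)) = (LINT s:?R|varm. f (left_ext s)) + (LINT s:?C|varm. f (left_ext s))"
    "(LINT s:{0<..t}|varm. jump_mean f s) = (LINT s:?R|varm. jump_mean f s) + (LINT s:?C|varm. jump_mean f s)"
    using occ(3) by (intro split; measurable)+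
  show "(LINT z|lborel. real_of_enat (level_up z x 0 t) * g z)
      = (LINT s:{0<..t}|pos_var x. g (left_lim x s))
        + (\<Sum>\<^sub>\<infinity>s\<in>J. LBINT z=left_lim x s..x s. (g z - g (left_lim x s)))"
    unfolding eqs splits by simp
  show "(LINT s:{0<..t}|pos_var x. g (left_lim x s))
        + (\<Sum>\<^sub>\<infinity>s\<in>J. LBINT z=left_lim x s..x s. (g z - g (left_lim x s)))
      = (LINT s:{0<..t}|pos_var (cont_part x). g (left_lim x s))
        + (\<Sum>\<^sub>\<infinity>s\<in>J. LBINT z=left_lim x s..x s. g z)"
    unfolding eqs splits by simp
  show "(LINT s:{0<..t}|pos_var (cont_part x). g (left_lim x s))
        + (\<Sum>\<^sub>\<infinity>s\<in>J. LBINT z=left_lim x s..x s. g z)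
      = (LINT s:{0<..t}|pos_var (cont_part x). g (x s))
        + (\<Sum>\<^sub>\<infinity>s\<in>J. LBINT z=left_lim x s..x s. g z)"
    unfolding eqs by simp
qed

end

section \<open>Downcrossings by reflection\<close>

lemma level_up_uminus: "level_up z (\<lambda>u. - x u) s t = level_down (- z) x s t"
  by (simp add: level_up_def level_down_def upcrossings_def)

lemma pos_var_uminus: "pos_var (\<lambda>s. - x s) = neg_var x"
  by (simp add: pos_var_def neg_var_def DTV_eq_UTV_uminus)

lemma cont_part_uminus:
  assumes "x \<in> cadlag_fv"
  shows "cont_part (\<lambda>s. - x s) = (\<lambda>s. - cont_part x s)"
proof
  fix s
  have "(\<Sum>\<^sub>\<infinity>u\<in>{0<..s}. jump (\<lambda>s. - x s) u) = (\<Sum>\<^sub>\<infinity>u\<in>{0<..s}. - jump x u)"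
    by (intro infsum_cong) (simp add: jump_uminus[OF assms])
  then show "cont_part (\<lambda>s. - x s) s = - cont_part x s"
    by (simp add: cont_part_def infsum_uminus)
qed

lemma (in fv_path) down_formula:
  assumes t: "t > 0" and g: "g \<in> borel_measurable borel" and lb: "locally_bounded g"
  defines "J \<equiv> {s\<in>{0<..t}. jump x s < 0}"
  shows "AE z in lborel. level_down z x 0 t < \<infinity>"
    "integrable lborel (\<lambda>z. real_of_enat (level_down z x 0 t) * g z)"
    "set_integrable (neg_var x) {0<..t} (\<lambda>s. g (left_lim x s))"
    "set_integrable (neg_var (cont_part x)) {0<..t} (\<lambda>s. g (left_lim x s))"
    "set_integrable (neg_var (cont_part x)) {0<..t} (\<lambda>s. g (x s))"
    "\<forall>s\<in>J. interval_lebesgue_integrable lborel (x s) (left_lim x s) g"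
    "(\<lambda>s. LBINT z=x s..left_lim x s. (g z - g (left_lim x s))) summable_on J"
    "(\<lambda>s. LBINT z=x s..left_lim x s. g z) summable_on J"
    "(LINT z|lborel. real_of_enat (level_down z x 0 t) * g z)
      = (LINT s:{0<..t}|neg_var x. g (left_lim x s))
        + (\<Sum>\<^sub>\<infinity>s\<in>J. LBINT z=x s..left_lim x s. (g z - g (left_lim x s)))"
    "(LINT s:{0<..t}|neg_var x. g (left_lim x s))
        + (\<Sum>\<^sub>\<infinity>s\<in>J. LBINT z=x s..left_lim x s. (g z - g (left_lim x s)))
      = (LINT s:{0<..t}|neg_var (cont_part x). g (left_lim x s))
        + (\<Sum>\<^sub>\<infinity>s\<in>J. LBINT z=x s..left_lim x s. g z)"
    "(LINT s:{0<..t}|neg_var (cont_part x). g (left_lim x s))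
        + (\<Sum>\<^sub>\<infinity>s\<in>J. LBINT z=x s..left_lim x s. g z)
      = (LINT s:{0<..t}|neg_var (cont_part x). g (x s))
        + (\<Sum>\<^sub>\<infinity>s\<in>J. LBINT z=x s..left_lim x s. g z)"
proof -
  let ?y = "\<lambda>s. - x s" and ?h = "\<lambda>z. g (- z)"
  interpret Y: fv_path ?y by (rule fv_path_uminus)
  have h: "?h \<in> borel_measurable borel" using g by measurable
  have lbh: "locally_bounded ?h"
    unfolding locally_bounded_def
  proof
    fix z
    obtain U where U: "open U" "- z \<in> U" "bounded (g ` U)" using lb unfolding locally_bounded_def by blast
    have "?h ` (uminus ` U) = g ` U" by (auto simp: image_image)
    then show "\<exists>U. open U \<and> z \<in> U \<and> bounded (?h ` U)"
      using U open_negations[OF U(1)] by (intro exI[of _ "uminus ` U"]) (auto simp: image_iff intro: bexI[of _ "- z"])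
  qed
  have ll: "left_lim ?y s = - left_lim x s" if "s > 0" for s
    using left_lim_uminus[OF tendsto_left_lim[OF that]] .
  have J: "{s\<in>{0<..t}. jump ?y s > 0} = J"
    by (auto simp: J_def jump_uminus[OF x_fv])
  have lls: "left_lim ?y s = - left_lim x s" if "s \<in> J" for s
    using that by (intro ll) (simp add: J_def)
  have ind: "(\<lambda>s. indicator {0<..t} s *\<^sub>R ?h (left_lim ?y s)) = (\<lambda>s. indicator {0<..t} s *\<^sub>R g (left_lim x s))"
    by (auto simp: indicator_def ll fun_eq_iff)
  have set1: "set_integrable M {0<..t} (\<lambda>s. ?h (left_lim ?y s)) = set_integrable M {0<..t} (\<lambda>s. g (left_lim x s))"
    "(LINT s:{0<..t}|M. ?h (left_lim ?y s)) = (LINT s:{0<..t}|M. g (left_lim x s))" for M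
    unfolding set_integrable_def set_lebesgue_integral_def ind by simp_all
  \<comment> \<open>Reflecting the variable maps the interval from \<open>- left_lim x s\<close> to
    \<open>- x s\<close> onto the one from \<open>x s\<close> to
    \<open>left_lim x s\<close>.\<close>
  have LB: "(LBINT z=left_lim ?y s..?y s. ?h z) = (LBINT z=x s..left_lim x s. g z)"
    "(LBINT z=left_lim ?y s..?y s. (?h z - ?h (left_lim ?y s))) = (LBINT z=x s..left_lim x s. (g z - g (left_lim x s)))"
    "interval_lebesgue_integrable lborel (left_lim ?y s) (?y s) ?h = interval_lebesgue_integrable lborel (x s) (left_lim x s) g"
    if "s \<in> J" for s
    using interval_integral_reflect[of "ereal (x s)" "ereal (left_lim x s)" g]
      interval_integral_reflect[of "ereal (x s)" "ereal (left_lim x s)" "\<lambda>z. g z - g (left_lim x s)"]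
      interval_integrable_mirror[of "ereal (- left_lim x s)" "ereal (- x s)" g]
    by (simp_all add: lls[OF that])
  have sums: "(\<Sum>\<^sub>\<infinity>s\<in>J. LBINT z=left_lim ?y s..?y s. ?h z) = (\<Sum>\<^sub>\<infinity>s\<in>J. LBINT z=x s..left_lim x s. g z)"
    "(\<Sum>\<^sub>\<infinity>s\<in>J. LBINT z=left_lim ?y s..?y s. (?h z - ?h (left_lim ?y s)))
      = (\<Sum>\<^sub>\<infinity>s\<in>J. LBINT z=x s..left_lim x s. (g z - g (left_lim x s)))"
    by (intro infsum_cong LB; assumption)+
  have summ: "(\<lambda>s. LBINT z=left_lim ?y s..?y s. ?h z) summable_on J \<longleftrightarrow> (\<lambda>s. LBINT z=x s..left_lim x s. g z) summable_on J"
    "(\<lambda>s. LBINT z=left_lim ?y s..?y s. (?h z - ?h (left_lim ?y s))) summable_on J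
      \<longleftrightarrow> (\<lambda>s. LBINT z=x s..left_lim x s. (g z - g (left_lim x s))) summable_on J"
    by (intro summable_on_cong LB; assumption)+
  have pv: "pos_var ?y = neg_var x" "pos_var (cont_part ?y) = neg_var (cont_part x)"
    by (simp_all add: pos_var_uminus cont_part_uminus[OF x_fv])
  let ?F = "\<lambda>z. real_of_enat (level_down z x 0 t) * g z"
  have F: "(\<lambda>z. real_of_enat (level_up z ?y 0 t) * ?h z) = (\<lambda>z. ?F (0 + (-1) * z))"
    by (simp add: level_up_uminus)
  have Fint: "integrable lborel (\<lambda>z. real_of_enat (level_up z ?y 0 t) * ?h z) \<longleftrightarrow> integrable lborel ?F"
    "(LINT z|lborel. real_of_enat (level_up z ?y 0 t) * ?h z) = (LINT z|lborel. ?F z)"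
    unfolding F using lborel_integrable_real_affine_iff[of "-1" ?F 0] lborel_integral_real_affine[of "-1" ?F 0]
    by simp_all
  note up = Y.up_formula[OF t h lbh, unfolded J sums summ pv Fint set1]
  show "AE z in lborel. level_down z x 0 t < \<infinity>"
  proof -
    note [measurable] = Y.measurable_level_up_count[OF t]
    \<comment> \<open>Reflecting an almost-everywhere statement asks for a measurable predicate,
      which \<open>level_up_count\<close> provides.\<close>
    have eq: "level_up_count ?y t z < \<infinity> \<longleftrightarrow> level_down (- z) x 0 t < \<infinity>" for z
      by (cases "level_down (- z) x 0 t") (simp_all add: level_up_count_def level_up_uminus of_nat_less_top)
    have "AE z in lborel. level_up_count ?y t z < \<infinity>"
      using up(1) unfolding eq level_up_uminus .
    then have "AE z in lborel. level_up_count ?y t (0 + (-1) * z) < \<infinity>"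
      by (intro AE_borel_affine) (simp, measurable)
    then show ?thesis unfolding eq by simp
  qed
  show "integrable lborel ?F"
    "set_integrable (neg_var x) {0<..t} (\<lambda>s. g (left_lim x s))"
    "set_integrable (neg_var (cont_part x)) {0<..t} (\<lambda>s. g (left_lim x s))"
    "(\<lambda>s. LBINT z=x s..left_lim x s. (g z - g (left_lim x s))) summable_on J"
    "(\<lambda>s. LBINT z=x s..left_lim x s. g z) summable_on J"
    by (fact up)+
  show "set_integrable (neg_var (cont_part x)) {0<..t} (\<lambda>s. g (x s))"
    using up(5) by simp
  show "\<forall>s\<in>J. interval_lebesgue_integrable lborel (x s) (left_lim x s) g"
    using up(6) LB(3) by blast
  show "(LINT z|lborel. ?F z) = (LINT s:{0<..t}|neg_var x. g (left_lim x s))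
      + (\<Sum>\<^sub>\<infinity>s\<in>J. LBINT z=x s..left_lim x s. (g z - g (left_lim x s)))"
    by (fact up(9))
  show "(LINT s:{0<..t}|neg_var x. g (left_lim x s))
        + (\<Sum>\<^sub>\<infinity>s\<in>J. LBINT z=x s..left_lim x s. (g z - g (left_lim x s)))
      = (LINT s:{0<..t}|neg_var (cont_part x). g (left_lim x s))
        + (\<Sum>\<^sub>\<infinity>s\<in>J. LBINT z=x s..left_lim x s. g z)"
    by (fact up(10))
  show "(LINT s:{0<..t}|neg_var (cont_part x). g (left_lim x s))
        + (\<Sum>\<^sub>\<infinity>s\<in>J. LBINT z=x s..left_lim x s. g z)
      = (LINT s:{0<..t}|neg_var (cont_part x). g (x s))
        + (\<Sum>\<^sub>\<infinity>s\<in>J. LBINT z=x s..left_lim x s. g z)"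
    using up(11) by simp
qed

text \<open>The integrability, summability and finiteness claims give the equalities their meaning:
  Bochner integrals and \<open>infsum\<close> are 0 when undefined, and \<open>real_of_enat\<close>
  is 0 at infinity.\<close>

theorem theorem2p8:
  fixes x g :: "real \<Rightarrow> real" and t :: real
  assumes "x \<in> cadlag_fv"
    and "t > 0"
    and "g \<in> borel_measurable borel"
    and "locally_bounded g"
  shows
    "(AE z in lborel. level_up z x 0 t < \<infinity>) \<and>
      integrable lborel (\<lambda>z. real_of_enat (level_up z x 0 t) * g z) \<and>
      set_integrable (pos_var x) {0<..t} (\<lambda>s. g (left_lim x s)) \<and>
      set_integrable (pos_var (cont_part x)) {0<..t} (\<lambda>s. g (left_lim x s)) \<and>
      set_integrable (pos_var (cont_part x)) {0<..t} (\<lambda>s. g (x s)) \<and>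
      (\<forall>s\<in>{s\<in>{0<..t}. jump x s > 0}. interval_lebesgue_integrable lborel (left_lim x s) (x s) g) \<and>
      (\<lambda>s. LBINT z=left_lim x s..x s. (g z - g (left_lim x s))) summable_on {s\<in>{0<..t}. jump x s > 0} \<and>
      (\<lambda>s. LBINT z=left_lim x s..x s. g z) summable_on {s\<in>{0<..t}. jump x s > 0} \<and>
      (LINT z|lborel. real_of_enat (level_up z x 0 t) * g z)
        = (LINT s:{0<..t}|pos_var x. g (left_lim x s))
          + (\<Sum>\<^sub>\<infinity>s\<in>{s\<in>{0<..t}. jump x s > 0}. LBINT z=left_lim x s..x s. (g z - g (left_lim x s))) \<and>
      (LINT s:{0<..t}|pos_var x. g (left_lim x s))
          + (\<Sum>\<^sub>\<infinity>s\<in>{s\<in>{0<..t}. jump x s > 0}. LBINT z=left_lim x s..x s. (g z - g (left_lim x s)))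
        = (LINT s:{0<..t}|pos_var (cont_part x). g (left_lim x s))
          + (\<Sum>\<^sub>\<infinity>s\<in>{s\<in>{0<..t}. jump x s > 0}. LBINT z=left_lim x s..x s. g z) \<and>
      (LINT s:{0<..t}|pos_var (cont_part x). g (left_lim x s))
          + (\<Sum>\<^sub>\<infinity>s\<in>{s\<in>{0<..t}. jump x s > 0}. LBINT z=left_lim x s..x s. g z)
        = (LINT s:{0<..t}|pos_var (cont_part x). g (x s))
          + (\<Sum>\<^sub>\<infinity>s\<in>{s\<in>{0<..t}. jump x s > 0}. LBINT z=left_lim x s..x s. g z) \<and>
      (AE z in lborel. level_down z x 0 t < \<infinity>) \<and>
      integrable lborel (\<lambda>z. real_of_enat (level_down z x 0 t) * g z) \<and>
      set_integrable (neg_var x) {0<..t} (\<lambda>s. g (left_lim x s)) \<and>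
      set_integrable (neg_var (cont_part x)) {0<..t} (\<lambda>s. g (left_lim x s)) \<and>
      set_integrable (neg_var (cont_part x)) {0<..t} (\<lambda>s. g (x s)) \<and>
      (\<forall>s\<in>{s\<in>{0<..t}. jump x s < 0}. interval_lebesgue_integrable lborel (x s) (left_lim x s) g) \<and>
      (\<lambda>s. LBINT z=x s..left_lim x s. (g z - g (left_lim x s))) summable_on {s\<in>{0<..t}. jump x s < 0} \<and>
      (\<lambda>s. LBINT z=x s..left_lim x s. g z) summable_on {s\<in>{0<..t}. jump x s < 0} \<and>
      (LINT z|lborel. real_of_enat (level_down z x 0 t) * g z)
        = (LINT s:{0<..t}|neg_var x. g (left_lim x s))
          + (\<Sum>\<^sub>\<infinity>s\<in>{s\<in>{0<..t}. jump x s < 0}. LBINT z=x s..left_lim x s. (g z - g (left_lim x s))) \<and>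
      (LINT s:{0<..t}|neg_var x. g (left_lim x s))
          + (\<Sum>\<^sub>\<infinity>s\<in>{s\<in>{0<..t}. jump x s < 0}. LBINT z=x s..left_lim x s. (g z - g (left_lim x s)))
        = (LINT s:{0<..t}|neg_var (cont_part x). g (left_lim x s))
          + (\<Sum>\<^sub>\<infinity>s\<in>{s\<in>{0<..t}. jump x s < 0}. LBINT z=x s..left_lim x s. g z) \<and>
      (LINT s:{0<..t}|neg_var (cont_part x). g (left_lim x s))
          + (\<Sum>\<^sub>\<infinity>s\<in>{s\<in>{0<..t}. jump x s < 0}. LBINT z=x s..left_lim x s. g z)
        = (LINT s:{0<..t}|neg_var (cont_part x). g (x s))
          + (\<Sum>\<^sub>\<infinity>s\<in>{s\<in>{0<..t}. jump x s < 0}. LBINT z=x s..left_lim x s. g z)"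
proof -
  interpret fv_path x by unfold_locales fact
  show ?thesis
    by (intro conjI; fact up_formula[OF assms(2-4)] down_formula[OF assms(2-4)])
qed

end
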